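(* Let $b\ge 2$ and $d\ge 1$ be integers, and let $W$ be a real random variable satisfying $$W\ge 0,\qquad \mathbb{E}W=1,\qquad \mathbb{E}[W\log_2^+W]<\infty,\qquad \mathbb{E}[W\log_2 W]<d\log_2 b .$$ Let $\mu$ be the canonical $b$-adic Mandelbrot cascade on $[0,1]^d$ generated by $W$. Then, almost surely on the event $\{\mu\ne 0\}$, $$\dim_{\mathrm F}(\mu)\le 2 .$$
   Context: Conventions: $\log_2^+x=\max\{\log_2x,0\}$ and $0\log_2 0=0$. Construction of the cascade. Put $B=b^d$. Label the $B$ first-generation $b$-adic subcubes of $[0,1]^d$ (side length $b^{-1}$) by $\{1,\dots,B\}$, and let $T_B=\bigcup_{n\ge0}\{1,\dots,B\}^n$ be the rooted $B$-ary tree, with $\{1,\dots,B\}^0=\{\varnothing\}$. For $u\in T_B$ of length $|u|=n$, let $Q_u=a_u+b^{-n}[0,1]^d$ be the corresponding $b$-adic cube of generation $n$ (obtained by iterating the labelling), with lower-left corner $a_u$. Let $\{W_u:u\in T_B\setminus\{\varnothing\}\}$ be independent copies of $W$. For $u=(u_1,\dots,u_n)$ let $u|k=(u_1,\dots,u_k)$ and $Y_u=\prod_{k=1}^nW_{u|k}$, with $Y_\varnothing=1$. Define the random measure $\mu_n$ on $[0,1]^d$ by $$d\mu_n(x)=\sum_{|u|=n}Y_u\mathbf 1_{Q_u}(x)\,dx .$$ Under the stated hypotheses on $W$, $\mu_n$ converges weakly almost surely to a finite random measure $\mu$, the canonical $b$-adic Mandelbrot cascade on $[0,1]^d$. The event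 $\{\mu\ne0\}$ is the non-extinction event. Fourier dimension. For a nonzero finite Borel measure $\nu$ on $\mathbb{R}^m$, the Fourier transform is $\widehat\nu(\xi)=\int_{\mathbb{R}^m}e^{-2\pi i\langle x,\xi\rangle}\,d\nu(x)$, and $$\dim_{\mathrm F}(\nu)=\sup\{0\le s\le m:\ |\widehat\nu(\xi)|=O(|\xi|^{-s/2})\text{ as }|\xi|\to\infty\}.$$ *)

theory Defs
  imports "HOL-Probability.Probability" "HOL-Library.Landau_Symbols"
begin

section \<open>The Fourier dimension of a measure\<close>

definition fourier_transform :: "'a::euclidean_space measure \<Rightarrow> 'a \<Rightarrow> complex" where
  "fourier_transform \<nu> \<xi> = (\<integral>x. exp (- 2 * complex_of_real pi * \<i> * complex_of_real (x \<bullet> \<xi>)) \<partial>\<nu>)"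

text \<open>The set below contains \<open>0\<close> whenever \<open>\<nu>\<close> is finite, and it is bounded by \<open>DIM('a)\<close>.\<close>

definition fourier_dim :: "'a::euclidean_space measure \<Rightarrow> real" where
  "fourier_dim \<nu> = Sup {s. 0 \<le> s \<and> s \<le> real DIM('a) \<and>
     (\<lambda>\<xi>. norm (fourier_transform \<nu> \<xi>)) \<in> O[at_infinity](\<lambda>\<xi>. norm \<xi> powr (- s / 2))}"


section \<open>Finite random measures and weak convergence\<close>

definition weakly_converges ::
    "(nat \<Rightarrow> 'a::topological_space measure) \<Rightarrow> 'a measure \<Rightarrow> bool" where
  "weakly_converges \<nu> \<nu>' \<longleftrightarrow>
     (\<forall>f :: 'a \<Rightarrow> real. continuous_on UNIV f \<and> bounded (range f) \<longrightarrow>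
        (\<lambda>n. \<integral>x. f x \<partial>(\<nu> n)) \<longlonglongrightarrow> (\<integral>x. f x \<partial>\<nu>'))"

definition finite_random_measure ::
    "'w measure \<Rightarrow> ('w \<Rightarrow> 'a::topological_space measure) \<Rightarrow> bool" where
  "finite_random_measure M \<mu> \<longleftrightarrow>
     (\<forall>\<omega>\<in>space M. finite_measure (\<mu> \<omega>) \<and> sets (\<mu> \<omega>) = sets borel) \<and>
     (\<forall>A\<in>sets borel. (\<lambda>\<omega>. emeasure (\<mu> \<omega>) A) \<in> borel_measurable M)"


section \<open>The canonical b-adic Mandelbrot cascade on the unit cube\<close>

text \<open>A vertex of the rooted \<open>B\<close>-ary tree is a list of labels in \<open>{1..B}\<close>; the root is \<open>[]\<close>.\<close>

definition tree :: "nat \<Rightarrow> nat list set" where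
  "tree B = {u. set u \<subseteq> {1..B}}"

definition generation :: "nat \<Rightarrow> nat \<Rightarrow> nat list set" where
  "generation B n = {u \<in> tree B. length u = n}"

text \<open>A first-generation subcube is represented by its lower-left corner, so a labelling \<open>c\<close>
  enumerates the points of the unit cube whose coordinates are \<open>0/b, \<dots>, (b-1)/b\<close>.\<close>

definition subcube_labelling :: "nat \<Rightarrow> (nat \<Rightarrow> real ^ 'd) \<Rightarrow> bool" where
  "subcube_labelling b c \<longleftrightarrow>
     bij_betw c {1..b ^ CARD('d)} {v. \<forall>i. \<exists>j<b. v $ i = real j / real b}"

text \<open>The cube of the word \<open>i # u\<close> is the image of the cube of \<open>u\<close> under the similarity
  mapping the unit cube onto the first-generation cube with label \<open>i\<close>; hence
  the corner of \<open>u\<close> is the sum of \<open>b\<^sup>-\<^sup>k c (u ! k)\<close> over \<open>k < length u\<close>.\<close>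

primrec corner :: "nat \<Rightarrow> (nat \<Rightarrow> real ^ 'd) \<Rightarrow> nat list \<Rightarrow> real ^ 'd" where
  "corner b c [] = 0"
| "corner b c (i # u) = c i + (1 / real b) *\<^sub>R corner b c u"

definition cube :: "nat \<Rightarrow> (nat \<Rightarrow> real ^ 'd) \<Rightarrow> nat list \<Rightarrow> (real ^ 'd) set" where
  "cube b c u = (\<lambda>x. corner b c u + (1 / real b ^ length u) *\<^sub>R x) ` cbox 0 1"

definition path_product :: "(nat list \<Rightarrow> 'w \<Rightarrow> real) \<Rightarrow> nat list \<Rightarrow> 'w \<Rightarrow> real" where
  "path_product X u \<omega> = (\<Prod>k = 1..length u. X (take k u) \<omega>)"

definition cascade_approx ::
    "nat \<Rightarrow> (nat \<Rightarrow> real ^ 'd) \<Rightarrow> (nat list \<Rightarrow> 'w \<Rightarrow> real) \<Rightarrow> nat \<Rightarrow> 'w \<Rightarrow> (real ^ 'd) measure" where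
  "cascade_approx b c X n \<omega> = density lborel
     (\<lambda>x. \<Sum>u\<in>generation (b ^ CARD('d)) n. ennreal (path_product X u \<omega>) * indicator (cube b c u) x)"

text \<open>The cascade is the almost sure weak limit, so it is determined up to a null set.\<close>

definition mandelbrot_cascade ::
    "'w measure \<Rightarrow> nat \<Rightarrow> (nat \<Rightarrow> real ^ 'd) \<Rightarrow> (nat list \<Rightarrow> 'w \<Rightarrow> real) \<Rightarrow>
     ('w \<Rightarrow> (real ^ 'd) measure) \<Rightarrow> bool" where
  "mandelbrot_cascade M b c X \<mu> \<longleftrightarrow>
     finite_random_measure M \<mu> \<and>
     (AE \<omega> in M. weakly_converges (\<lambda>n. cascade_approx b c X n \<omega>) (\<mu> \<omega>))"

text \<open>The copies may live on a different probability space from the given variable.\<close>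

definition independent_copies ::
    "'w measure \<Rightarrow> 'i set \<Rightarrow> ('i \<Rightarrow> 'w \<Rightarrow> real) \<Rightarrow> 'v measure \<Rightarrow> ('v \<Rightarrow> real) \<Rightarrow> bool" where
  "independent_copies M I X N W \<longleftrightarrow>
     prob_space.indep_vars M (\<lambda>_. borel) X I \<and>
     (\<forall>i\<in>I. distr M borel (X i) = distr N borel W)"

end

theory Submission
  imports Defs
begin

text \<open>
  Suppose \<open>|fourier_transform \<mu> \<xi>| = O(|\<xi>| powr - \<sigma>)\<close> with \<open>\<sigma> > 1\<close>, and project \<open>\<mu>\<close> onto a
  coordinate axis. The projection has an integrable Fourier transform, so it has a continuous
  density \<open>f\<close> on the line. It lives on \<open>[0,1]\<close>, hence \<open>f 0 = f 1 = 0\<close>. If the cascades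
  in all subcubes had the same decay, their projected densities would vanish at \<open>0\<close> and \<open>1\<close> too; since
  \<open>f\<close> is a combination of rescaled copies of the densities of the cubes of generation \<open>m\<close>, it would
  vanish at all points \<open>k / b ^ m\<close>. Letting \<open>m\<close> vary, \<open>f = 0\<close> by continuity, and \<open>\<mu>\<close> has no mass
  (\<open>all_decaying_imp_mass_zero\<close>).

  What makes the subcascades decay is a zero-one law (\<open>decaying_zero_one\<close>): if
  with positive probability the transform of \<open>\<mu>\<close> decays at rate \<open>\<sigma>\<close> while \<open>\<mu>\<close> survives, then it
  decays at rate \<open>\<sigma>\<close> almost surely. Indeed that event is almost determined by finitely many
  weights (\<open>PiM_finite_coordinates_approx\<close>), so one can fix all weights
  outside the subtree of some vertex \<open>u\<close> with \<open>Y\<^sub>u > 0\<close> and keep decay with conditional probability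
  at least \<open>1 - \<epsilon>\<close> when the subtree of \<open>u\<close> is resampled. The subtree enters the transform through one
  summand, a nonzero multiple of a rescaled copy of the transform of an independent
  cascade. Hence the transform of a cascade lies in a fixed coset \<open>k + L\<close> of the linear space \<open>L\<close> of
  decaying functions with probability at least \<open>1 - \<epsilon>\<close>. Cosets belonging to two values of \<open>\<epsilon>\<close> whose sum
  is less than \<open>1\<close> meet, so they coincide, and the transform lies in \<open>k + L\<close> almost surely; as it lies in
  \<open>L\<close> with positive probability, \<open>k + L = L\<close>. Subcascades have the law of the whole
  cascade, so almost surely all of them decay.

  Since only the transform along one axis matters, the argument is carried out for the random
  exponential sums \<open>transform x n t\<close>, in which the mass of a cube sits at the projection of its corner,
  and for limits at rational frequencies only, which keeps all events measurable. Weak convergence of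
  the cascade identifies the limits of these sums with the transform of \<open>\<mu>\<close>
  (\<open>transform_tendsto_fourier_integral\<close>).
\<close>

section \<open>Measures on the line with an integrable Fourier transform\<close>

lemma integrable_polynomial_decay:
  fixes \<sigma> :: real
  assumes "\<sigma> > 1"
  shows "integrable lborel (\<lambda>s. (1 + \<bar>s\<bar>) powr - \<sigma>)"
proof -
  define g :: "real \<Rightarrow> real" where "g = (\<lambda>s. indicator {0..} s * (1 + \<bar>s\<bar>) powr - \<sigma>)"
  have lim: "((\<lambda>s. (1 + s) powr (1 - \<sigma>) / (1 - \<sigma>)) \<longlongrightarrow> 0) at_top"
  proof -
    have "((\<lambda>s. (1 + s) powr (1 - \<sigma>)) \<longlongrightarrow> 0) at_top"
      using assms
      by (intro tendsto_neg_powr filterlim_tendsto_add_at_top[OF tendsto_const filterlim_ident]) simp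
    then show ?thesis by (simp add: tendsto_divide_zero)
  qed
  have "(\<integral>\<^sup>+s. ennreal ((1 + \<bar>s\<bar>) powr - \<sigma>) * indicator {0..} s \<partial>lborel)
      = ennreal (0 - (1 + 0) powr (1 - \<sigma>) / (1 - \<sigma>))"
  proof (rule nn_integral_FTC_atLeast[OF _ _ _ lim])
    fix s :: real assume "0 \<le> s"
    then show "((\<lambda>s. (1 + s) powr (1 - \<sigma>) / (1 - \<sigma>)) has_real_derivative (1 + \<bar>s\<bar>) powr - \<sigma>) (at s)"
      using DERIV_cdivide[OF DERIV_fun_powr[of "\<lambda>s. 1 + s" 1 s "1 - \<sigma>"], of "1 - \<sigma>"] assms
      by (auto intro!: derivative_eq_intros)
  qed auto
  then have "integrable lborel g"
    unfolding g_def
    by (intro integrableI_nonneg) (auto simp: ennreal_mult' mult.commute ennreal_indicator)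
  moreover from lborel_integrable_real_affine[OF this, of "-1" 0]
  have "integrable lborel (\<lambda>s. g (- s))" by simp
  ultimately have "integrable lborel (\<lambda>s. g s + g (- s))" by (rule Bochner_Integration.integrable_add)
  then show ?thesis
    by (rule Bochner_Integration.integrable_bound) (auto simp: g_def indicator_def)
qed

lemma gaussian_eq_fourier_integral:
  "complex_of_real (exp (- (x\<^sup>2) / 2)) = (CLINT T|std_normal_distribution. cis (T * x))"
proof -
  have "complex_of_real (exp (- (x\<^sup>2) / 2)) = char std_normal_distribution x"
    by (simp add: char_std_normal_distribution)
  then show ?thesis by (simp add: char_def cis_conv_exp mult.commute)
qed

text \<open>
  The point masses \<open>w u\<close> at \<open>p u\<close>, \<open>u \<in> S n\<close>, play the role of approximations to a measure with
  Fourier transform \<open>h\<close>. Writing the Gaussian as the transform of the normal law turns the convolution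
  of these masses with \<open>r * exp (- (r y)\<^sup>2 / 2)\<close> into an integral of their transform, in which \<open>n \<rightarrow> \<infinity>\<close> is
  harmless. As \<open>h\<close> is integrable, \<open>r \<rightarrow> \<infinity>\<close> gives Fourier inversion: up to the factor \<open>sqrt (2 pi)\<close>,
  \<open>f\<close> is the density of the limit measure, without that measure being constructed. The uniformity
  in \<open>y\<close> is needed to recover the total mass from \<open>f\<close>.
\<close>

lemma gaussian_mollification_uniform_limit:
  fixes S :: "nat \<Rightarrow> 'a set" and w p :: "'a \<Rightarrow> real" and h :: "real \<Rightarrow> complex"
  assumes fin: "\<And>n. finite (S n)"
    and nonneg: "\<And>n u. u \<in> S n \<Longrightarrow> 0 \<le> w u"
    and lim: "\<And>t. (\<lambda>n. \<Sum>u\<in>S n. of_real (w u) * cis (t * p u)) \<longlonglongrightarrow> h t"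
    and decay: "\<And>t. norm (h t) \<le> C * (1 + \<bar>t\<bar>) powr - \<sigma>"
    and "\<sigma> > 1"
  obtains f g where "uniform_limit UNIV g f sequentially" "\<And>y. isCont f y"
    "\<And>r y. r > 0 \<Longrightarrow> (\<lambda>n. real r * (\<Sum>u\<in>S n. w u * exp (- ((real r * (y - p u))\<^sup>2) / 2))) \<longlonglongrightarrow> g r y"
proof -
  define \<phi> where "\<phi> n t = (\<Sum>u\<in>S n. complex_of_real (w u) * cis (t * p u))" for n t
  have lim': "(\<lambda>n. \<phi> n t) \<longlonglongrightarrow> h t" for t using lim by (simp add: \<phi>_def)
  have \<phi>_meas[measurable]: "\<phi> n \<in> borel_measurable borel" for n
    unfolding \<phi>_def cis_conv_exp by measurable
  have h_meas[measurable]: "h \<in> borel_measurable borel"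
    by (rule borel_measurable_LIMSEQ_metric[OF \<phi>_meas lim'])
  have norm_\<phi>: "norm (\<phi> n t) \<le> Re (\<phi> n 0)" for n t
  proof -
    have "norm (\<phi> n t) \<le> (\<Sum>u\<in>S n. norm (of_real (w u) * cis (t * p u)))"
      unfolding \<phi>_def by (rule norm_sum)
    also have "\<dots> = Re (\<phi> n 0)"
      using nonneg by (auto simp: \<phi>_def norm_mult intro!: sum.cong)
    finally show ?thesis .
  qed
  obtain K where K: "norm (\<phi> n 0) \<le> K" for n
    using lim'[of 0] convergent_imp_Bseq by (metis Bseq_def convergent_def)
  have \<phi>_K: "norm (\<phi> n t) \<le> K" for n t
    using norm_\<phi>[of n t] K[of n] complex_Re_le_cmod[of "\<phi> n 0"] by linarith
  interpret N: prob_space std_normal_distribution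
    by (rule prob_space_normal_density) simp
  have cis_meas[measurable]: "(\<lambda>t. cis (f t)) \<in> borel_measurable borel" if [measurable]: "f \<in> borel_measurable borel" for f
    unfolding cis_conv_exp by measurable
  have h_int: "integrable lborel h"
    by (rule Bochner_Integration.integrable_bound[OF integrable_mult_right[OF integrable_polynomial_decay[OF \<open>\<sigma> > 1\<close>], of C]])
      (auto intro!: order_trans[OF decay abs_ge_self])
  define G where "G r y = (CLINT s|lborel. cis (- s * y) * h s * of_real (std_normal_density (s / r)))" for r y
  define F where "F y = (CLINT s|lborel. cis (- s * y) * h s * of_real (std_normal_density 0))" for y
  have dens_le: "std_normal_density s \<le> std_normal_density 0" for s
    by (simp add: std_normal_density_def divide_right_mono)
  have h_int': "integrable lborel (\<lambda>s. norm (h s) * std_normal_density 0)"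
    by (rule integrable_mult_left) (use h_int in auto)
  have G_int: "integrable lborel (\<lambda>s. cis (- s * y) * h s * of_real (std_normal_density (s / r)))" for r y
    by (rule Bochner_Integration.integrable_bound[OF h_int'])
      (auto simp: norm_mult normal_density_nonneg intro!: mult_left_mono dens_le)
  have F_int: "integrable lborel (\<lambda>s. cis (- s * y) * h s * of_real (std_normal_density 0))" for y
    using G_int[of y 0] by simp
  \<comment> \<open>substitute \<open>s = r T\<close> in the integral over the normal law\<close>
  have mollify: "(\<lambda>n. complex_of_real (r * (\<Sum>u\<in>S n. w u * exp (- ((r * (y - p u))\<^sup>2) / 2)))) \<longlonglongrightarrow> G r y"
    if r: "r > 0" for r y :: real
  proof -
    have eq: "complex_of_real (\<Sum>u\<in>S n. w u * exp (- ((r * (y - p u))\<^sup>2) / 2))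
        = (CLINT T|std_normal_distribution. cis (- (r * T) * y) * \<phi> n (r * T))" for n
    proof -
      have "complex_of_real (\<Sum>u\<in>S n. w u * exp (- ((r * (y - p u))\<^sup>2) / 2))
         = (\<Sum>u\<in>S n. of_real (w u) * of_real (exp (- ((r * (p u - y))\<^sup>2) / 2)))"
        by (simp add: power_mult_distrib power2_commute)
      also have "\<dots> = (\<Sum>u\<in>S n. of_real (w u) * (CLINT T|std_normal_distribution. cis (T * (r * (p u - y)))))"
        by (subst gaussian_eq_fourier_integral) simp
      also have "\<dots> = (CLINT T|std_normal_distribution. \<Sum>u\<in>S n. of_real (w u) * cis (T * (r * (p u - y))))"
        by (subst Bochner_Integration.integral_sum)
          (auto intro!: integrable_mult_right N.integrable_const_bound[where B=1])
      also have "\<dots> = (CLINT T|std_normal_distribution. cis (- (r * T) * y) * \<phi> n (r * T))"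
        by (intro Bochner_Integration.integral_cong refl)
          (simp add: \<phi>_def sum_distrib_left mult.left_commute cis_mult algebra_simps)
      finally show ?thesis .
    qed
    have L1: "(\<lambda>n. CLINT T|std_normal_distribution. cis (- (r * T) * y) * \<phi> n (r * T))
        \<longlonglongrightarrow> (CLINT T|std_normal_distribution. cis (- (r * T) * y) * h (r * T))"
      by (rule integral_dominated_convergence[where w="\<lambda>_. K"])
        (auto simp: norm_mult \<phi>_K intro!: tendsto_mult lim')
    have L2: "of_real r * (CLINT T|std_normal_distribution. cis (- (r * T) * y) * h (r * T)) = G r y"
    proof -
      have "(CLINT T|std_normal_distribution. cis (- (r * T) * y) * h (r * T))
          = (CLINT T|lborel. std_normal_density T *\<^sub>R (cis (- (r * T) * y) * h (r * T)))"
        by (subst integral_density) (auto simp: normal_density_nonneg)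
      also have "r * \<dots> = G r y"
        unfolding G_def
        by (subst (2) lborel_integral_real_affine[where c=r and t=0])
          (use r in \<open>simp_all add: scaleR_conv_of_real mult_ac\<close>)
      finally show ?thesis .
    qed
    show ?thesis
      using tendsto_mult_left[OF L1, of "of_real r"] unfolding L2 of_real_mult eq .
  qed
  have unif: "uniform_limit UNIV (\<lambda>r. Re \<circ> G (real r)) (Re \<circ> F) sequentially"
  proof -
    \<comment> \<open>\<open>\<eta> r\<close> bounds the distance between the mollification and its limit at every point\<close>
    define \<eta> where "\<eta> r = (\<integral>s. norm (h s) * (std_normal_density 0 - std_normal_density (s / r)) \<partial>lborel)" for r
    have "(\<lambda>r. \<eta> (real r)) \<longlonglongrightarrow> (\<integral>s. 0 \<partial>(lborel :: real measure))"
      unfolding \<eta>_def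
    proof (rule integral_dominated_convergence[where w="\<lambda>s. norm (h s) * std_normal_density 0"])
      show "AE s in lborel. (\<lambda>r. norm (h s) * (std_normal_density 0 - std_normal_density (s / real r))) \<longlonglongrightarrow> 0"
      proof (rule AE_I2)
        fix s :: real
        have "(\<lambda>r. s / real r) \<longlonglongrightarrow> 0"
          by (rule lim_const_over_n)
        then have "(\<lambda>r. std_normal_density (s / real r)) \<longlonglongrightarrow> std_normal_density 0"
          unfolding std_normal_density_def by (auto intro!: tendsto_eq_intros)
        then show "(\<lambda>r. norm (h s) * (std_normal_density 0 - std_normal_density (s / real r))) \<longlonglongrightarrow> 0"
          by (auto intro!: tendsto_eq_intros)
      qed
      show "AE s in lborel. norm (norm (h s) * (std_normal_density 0 - std_normal_density (s / real r)))
          \<le> norm (h s) * std_normal_density 0" for r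
        using dens_le by (auto simp: abs_mult normal_density_nonneg intro!: mult_left_mono)
    qed (use h_int in auto)
    then have \<eta>0: "(\<lambda>r. \<eta> (real r)) \<longlonglongrightarrow> 0" by simp
    have le: "dist ((Re \<circ> G r) y) ((Re \<circ> F) y) \<le> \<eta> r" for r y
    proof -
      have "dist ((Re \<circ> G r) y) ((Re \<circ> F) y) \<le> norm (F y - G r y)"
        using abs_Re_le_cmod[of "F y - G r y"] by (simp add: dist_real_def abs_minus_commute)
      also have "F y - G r y = (CLINT s|lborel. cis (- s * y) * h s * of_real (std_normal_density 0 - std_normal_density (s / r)))"
        unfolding F_def G_def by (subst Bochner_Integration.integral_diff[OF F_int G_int, symmetric])
          (simp add: algebra_simps)
      also have "norm \<dots> \<le> \<eta> r"
        unfolding \<eta>_def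
        by (rule order_trans[OF integral_norm_bound])
          (intro eq_refl Bochner_Integration.integral_cong refl,
           use dens_le in \<open>simp add: norm_mult abs_of_nonneg del: of_real_diff\<close>)
      finally show ?thesis .
    qed
    show ?thesis
      unfolding uniform_limit_iff
    proof (intro allI impI)
      fix e :: real assume "e > 0"
      from order_tendstoD(2)[OF \<eta>0 this]
      show "\<forall>\<^sub>F r in sequentially. \<forall>y\<in>UNIV. dist ((Re \<circ> G (real r)) y) ((Re \<circ> F) y) < e"
        by eventually_elim (use le le_less_trans in blast)
    qed
  qed
  have cont: "isCont (Re \<circ> F) y" for y
  proof (rule continuous_at_sequentiallyI)
    fix z :: "nat \<Rightarrow> real" assume z: "z \<longlonglongrightarrow> y"
    have "(\<lambda>n. F (z n)) \<longlonglongrightarrow> F y"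
      unfolding F_def
    proof (rule integral_dominated_convergence[where w="\<lambda>s. norm (h s) * std_normal_density 0"])
      show "AE s in lborel. (\<lambda>n. cis (- s * z n) * h s * of_real (std_normal_density 0))
          \<longlonglongrightarrow> cis (- s * y) * h s * of_real (std_normal_density 0)"
        unfolding cis_conv_exp by (auto intro!: tendsto_intros z)
    qed (use h_int in \<open>auto simp: norm_mult normal_density_nonneg\<close>)
    then show "(\<lambda>n. (Re \<circ> F) (z n)) \<longlonglongrightarrow> (Re \<circ> F) y" by (auto intro: tendsto_Re)
  qed
  have lim2: "(\<lambda>n. real r * (\<Sum>u\<in>S n. w u * exp (- ((real r * (y - p u))\<^sup>2) / 2))) \<longlonglongrightarrow> (Re \<circ> G (real r)) y"
    if "r > 0" for r y
    using tendsto_Re[OF mollify[of "real r" y]] that by simp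
  show thesis by (rule that[OF unif cont lim2])
qed

lemma norm_cis_diff_le: "norm (cis s - cis t) \<le> \<bar>s - t\<bar>"
proof -
  have "cis s - cis t = cis t * (cis (s - t) - 1)"
    by (simp add: right_diff_distrib cis_mult)
  then have "norm (cis s - cis t) = norm (cis (s - t) - 1)" by (simp add: norm_mult)
  also have "\<dots> \<le> \<bar>s - t\<bar>"
    using iexp_approx1[of "s - t" 0] by (simp add: cis_conv_exp)
  finally show ?thesis .
qed

text \<open>
  The limit along \<open>n\<close> is asked for at rational frequencies only, so that decay is determined by countably many
  random variables; for the sums considered here the other frequencies follow by equicontinuity.
\<close>

definition decaying :: "real \<Rightarrow> (nat \<Rightarrow> real \<Rightarrow> complex) \<Rightarrow> bool" where
  "decaying \<sigma> F \<longleftrightarrow> (\<exists>h C. \<forall>q\<in>\<rat>. (\<lambda>n. F n q) \<longlonglongrightarrow> h q \<and> norm (h q) \<le> C * (1 + \<bar>q\<bar>) powr - \<sigma>)"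

section \<open>Words and generations\<close>

lemma finite_generation: "finite (generation B n)"
proof -
  have "generation B n = {u. set u \<subseteq> {1..B} \<and> length u = n}"
    by (auto simp: generation_def tree_def)
  then show ?thesis by (simp add: finite_lists_length_eq)
qed

lemma generation_0 [simp]: "generation B 0 = {[]}"
  by (auto simp: generation_def tree_def)

lemma generation_length: "u \<in> generation B n \<Longrightarrow> length u = n"
  by (simp add: generation_def)

lemma generation_tree: "u \<in> generation B n \<Longrightarrow> u \<in> tree B"
  by (simp add: generation_def)

lemma tree_append: "u @ v \<in> tree B \<longleftrightarrow> u \<in> tree B \<and> v \<in> tree B"
  by (auto simp: tree_def)

lemma sum_generation_add:
  "(\<Sum>w\<in>generation B (m + n). f w) = (\<Sum>u\<in>generation B m. \<Sum>v\<in>generation B n. f (u @ v))"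
proof -
  have "(\<Sum>u\<in>generation B m. \<Sum>v\<in>generation B n. f (u @ v))
      = (\<Sum>(u, v)\<in>generation B m \<times> generation B n. f (u @ v))"
    by (simp add: sum.cartesian_product)
  also have "\<dots> = (\<Sum>w\<in>generation B (m + n). f w)"
    by (rule sum.reindex_bij_witness[where j="\<lambda>(u, v). u @ v" and i="\<lambda>w. (take m w, drop m w)"])
      (auto simp: generation_def tree_def dest: in_set_takeD in_set_dropD)
  finally show ?thesis by simp
qed

section \<open>The cascade projected onto a coordinate axis\<close>

text \<open>
  A realisation of the weights is a function \<open>x\<close> on words. The number \<open>B\<close> of labels and the first-generation
  positions \<open>a j\<close> of the projected corners are all that remains of the cubes; the
  dimension enters only through \<open>B\<close>.
\<close>

locale projected_cascade =
  fixes b B :: nat and a :: "nat \<Rightarrow> real"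
  assumes b: "2 \<le> b" and B: "1 \<le> B"
    and a: "\<And>j. j \<in> {1..B} \<Longrightarrow> \<exists>k<b. a j = real k / real b"
begin

primrec pos :: "nat list \<Rightarrow> real" where
  "pos [] = 0"
| "pos (j # u) = a j + pos u / real b"

definition weight :: "(nat list \<Rightarrow> real) \<Rightarrow> nat list \<Rightarrow> real" where
  "weight x u = (\<Prod>k = 1..length u. x (take k u)) / real B ^ length u"

definition transform :: "(nat list \<Rightarrow> real) \<Rightarrow> nat \<Rightarrow> real \<Rightarrow> complex" where
  "transform x n t = (\<Sum>u\<in>generation B n. of_real (weight x u) * cis (t * pos u))"

text \<open>The Gaussian is not normalised; the factor \<open>r\<close> is added where \<open>mollified\<close> is used.\<close>

definition mollified :: "(nat list \<Rightarrow> real) \<Rightarrow> nat \<Rightarrow> real \<Rightarrow> real \<Rightarrow> real" where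
  "mollified x n r y = (\<Sum>u\<in>generation B n. weight x u * exp (- ((r * (y - pos u))\<^sup>2) / 2))"

definition shifted :: "(nat list \<Rightarrow> real) \<Rightarrow> nat list \<Rightarrow> nat list \<Rightarrow> real" where
  "shifted x u = (\<lambda>v. x (u @ v))"

definition nonneg :: "(nat list \<Rightarrow> real) \<Rightarrow> bool" where
  "nonneg x \<longleftrightarrow> (\<forall>u\<in>tree B - {[]}. 0 \<le> x u)"

lemma b_pos: "real b > 0" using b by simp

lemma pos_append: "pos (u @ v) = pos u + pos v / real b ^ length u"
  by (induction u) (simp_all add: add_divide_distrib mult.commute)

lemma pos_badic:
  assumes "u \<in> tree B"
  obtains k where "k < b ^ length u" "pos u = real k / real b ^ length u"
proof -
  have "\<exists>k < b ^ length u. pos u = real k / real b ^ length u"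
    using assms
  proof (induction u)
    case (Cons j u)
    then obtain k where k: "k < b ^ length u" "pos u = real k / real b ^ length u"
      by (auto simp: tree_def)
    obtain l where l: "l < b" "a j = real l / real b"
      using a[of j] Cons.prems by (auto simp: tree_def)
    have "Suc l * b ^ length u \<le> b * b ^ length u" using l by (intro mult_right_mono) auto
    then have "l * b ^ length u + k < b ^ length (j # u)" using k by simp
    moreover have "pos (j # u) = real (l * b ^ length u + k) / real b ^ length (j # u)"
      using b k l by (simp add: field_simps)
    ultimately show ?case by blast
  qed auto
  then show thesis using that by blast
qed

lemma pos_bounds:
  assumes "u \<in> tree B"
  shows "0 \<le> pos u" "pos u \<le> 1"
proof -
  obtain k where "k < b ^ length u" "pos u = real k / real b ^ length u"
    using pos_badic[OF assms] by blast
  moreover then have "real k \<le> real b ^ length u"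
    by (metis less_imp_le of_nat_le_iff of_nat_power)
  ultimately show "0 \<le> pos u" "pos u \<le> 1"
    using b_pos by (auto simp: divide_le_eq)
qed

lemma weight_append: "weight x (u @ v) = weight x u * weight (shifted x u) v"
proof -
  have "(\<Prod>k = 1..length u + length v. x (take k (u @ v)))
      = (\<Prod>k = 1..length u. x (take k (u @ v))) * (\<Prod>k = length u + 1..length u + length v. x (take k (u @ v)))"
    by (rule prod.ub_add_nat) simp
  also have "(\<Prod>k = 1..length u. x (take k (u @ v))) = (\<Prod>k = 1..length u. x (take k u))"
    by (rule prod.cong) auto
  also have "(\<Prod>k = length u + 1..length u + length v. x (take k (u @ v)))
     = (\<Prod>k = 1..length v. shifted x u (take k v))"
    by (rule prod.reindex_bij_witness[where i="\<lambda>k. length u + k" and j="\<lambda>k. k - length u"])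
      (auto simp: shifted_def)
  finally show ?thesis by (simp add: weight_def power_add)
qed

lemma weight_nonneg: "nonneg x \<Longrightarrow> u \<in> tree B \<Longrightarrow> 0 \<le> weight x u"
  unfolding weight_def nonneg_def
  by (intro divide_nonneg_nonneg prod_nonneg) (auto simp: tree_def dest!: in_set_takeD)

lemma nonneg_sub: "nonneg x \<Longrightarrow> u \<in> tree B \<Longrightarrow> nonneg (shifted x u)"
  by (auto simp: nonneg_def shifted_def tree_append)

lemma transform_add:
  "transform x (m + n) t = (\<Sum>u\<in>generation B m. of_real (weight x u) * cis (t * pos u) * transform (shifted x u) n (t / real b ^ m))"
  unfolding transform_def sum_generation_add
proof (intro sum.cong refl, unfold sum_distrib_left, intro sum.cong refl)
  fix u v assume u: "u \<in> generation B m" and "v \<in> generation B n"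
  have "t * pos (u @ v) = t * pos u + t / real b ^ m * pos v"
    using u by (simp add: pos_append generation_length distrib_left)
  then have "cis (t * pos (u @ v)) = cis (t * pos u) * cis (t / real b ^ m * pos v)"
    by (simp only: cis_mult)
  then show "of_real (weight x (u @ v)) * cis (t * pos (u @ v))
     = of_real (weight x u) * cis (t * pos u) * (of_real (weight (shifted x u) v) * cis (t / real b ^ m * pos v))"
    by (simp add: weight_append)
qed

lemma mollified_add:
  "mollified x (m + n) (real b ^ m * r) y
    = (\<Sum>u\<in>generation B m. weight x u * mollified (shifted x u) n r (real b ^ m * (y - pos u)))"
  unfolding mollified_def sum_generation_add
proof (intro sum.cong refl, unfold sum_distrib_left, intro sum.cong refl)
  fix u v assume u: "u \<in> generation B m" and "v \<in> generation B n"
  have eq: "real b ^ m * r * (y - pos (u @ v)) = r * (real b ^ m * (y - pos u) - pos v)"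
    using b_pos u by (simp add: pos_append generation_length field_simps)
  show "weight x (u @ v) * exp (- ((real b ^ m * r * (y - pos (u @ v)))\<^sup>2) / 2)
     = weight x u * (weight (shifted x u) v * exp (- ((r * (real b ^ m * (y - pos u) - pos v))\<^sup>2) / 2))"
    unfolding eq weight_append by simp
qed

text \<open>All positions lie in \<open>[0,1]\<close>, so the sums are Lipschitz in \<open>t\<close> with the total mass as constant.\<close>

lemma norm_transform_diff:
  assumes "nonneg x"
  shows "norm (transform x n s - transform x n t) \<le> Re (transform x n 0) * \<bar>s - t\<bar>"
proof -
  have "norm (transform x n s - transform x n t) = norm (\<Sum>u\<in>generation B n. of_real (weight x u) * (cis (s * pos u) - cis (t * pos u)))"
    by (simp add: transform_def sum_subtractf right_diff_distrib)
  also have "\<dots> \<le> (\<Sum>u\<in>generation B n. weight x u * \<bar>s - t\<bar>)"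
  proof (rule sum_norm_le)
    fix u assume u: "u \<in> generation B n"
    then have "norm (cis (s * pos u) - cis (t * pos u)) \<le> \<bar>s - t\<bar> * pos u"
      using norm_cis_diff_le[of "s * pos u" "t * pos u"] pos_bounds(1)[OF generation_tree]
      by (auto simp: left_diff_distrib[symmetric] abs_mult)
    also have "\<dots> \<le> \<bar>s - t\<bar> * 1"
      using pos_bounds(2)[OF generation_tree[OF u]] by (intro mult_left_mono) auto
    finally show "norm (of_real (weight x u) * (cis (s * pos u) - cis (t * pos u))) \<le> weight x u * \<bar>s - t\<bar>"
      using weight_nonneg[OF assms generation_tree[OF u]] by (auto simp: norm_mult intro!: mult_left_mono)
  qed
  finally show ?thesis by (simp add: transform_def sum_distrib_right)
qed

lemma mass_bounded:
  assumes "decaying \<sigma> (transform x)"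
  obtains K where "K > 0" "\<And>n. Re (transform x n 0) \<le> K"
proof -
  from assms obtain h where "(\<lambda>n. transform x n 0) \<longlonglongrightarrow> h" unfolding decaying_def by (meson Rats_0)
  then have "Bseq (\<lambda>n. transform x n 0)" by (intro convergent_imp_Bseq convergentI)
  then obtain K where K: "K > 0" "\<forall>n. norm (transform x n 0) \<le> K" by (rule BseqE)
  show thesis
  proof (rule that[OF K(1)])
    show "Re (transform x n 0) \<le> K" for n
      using K(2) complex_Re_le_cmod[of "transform x n 0"] by (meson order_trans)
  qed
qed

text \<open>The common Lipschitz constant carries convergence and the bound from the rationals to the whole line.\<close>

lemma decaying_imp_all_real:
  assumes x: "nonneg x" and "decaying \<sigma> (transform x)"
  obtains h C where "\<And>t. (\<lambda>n. transform x n t) \<longlonglongrightarrow> h t" "\<And>t. norm (h t) \<le> C * (1 + \<bar>t\<bar>) powr - \<sigma>"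
proof -
  obtain h0 C where h0: "\<And>q. q \<in> \<rat> \<Longrightarrow> (\<lambda>n. transform x n q) \<longlonglongrightarrow> h0 q"
    and C: "\<And>q. q \<in> \<rat> \<Longrightarrow> norm (h0 q) \<le> C * (1 + \<bar>q\<bar>) powr - \<sigma>"
    using assms(2) unfolding decaying_def by blast
  obtain K where K: "K > 0" "\<And>n. Re (transform x n 0) \<le> K" using mass_bounded[OF assms(2)] by blast
  have lip: "norm (transform x n s - transform x n t) \<le> K * \<bar>s - t\<bar>" for n s t
    using norm_transform_diff[OF x, of n s t] mult_right_mono[OF K(2)[of n], of "\<bar>s - t\<bar>"] by simp
  have "Cauchy (\<lambda>n. transform x n t)" for t
  proof (rule metric_CauchyI)
    fix e :: real assume "e > 0"
    then have "t < t + e / (3 * K)" using K by simp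
    then obtain q where q: "q \<in> \<rat>" "t < q" "q < t + e / (3 * K)"
      using Rats_dense_in_real by metis
    then have tq: "K * \<bar>q - t\<bar> \<le> e / 3" using K by (simp add: field_simps)
    obtain N where N: "\<And>m n. m \<ge> N \<Longrightarrow> n \<ge> N \<Longrightarrow> dist (transform x m q) (transform x n q) < e / 3"
      using metric_CauchyD[OF LIMSEQ_imp_Cauchy[OF h0[OF q(1)]], of "e / 3"] \<open>e > 0\<close> by auto
    show "\<exists>N. \<forall>m\<ge>N. \<forall>n\<ge>N. dist (transform x m t) (transform x n t) < e"
    proof (intro exI allI impI)
      fix m n assume "m \<ge> N" "n \<ge> N"
      have "dist (transform x m t) (transform x n t) \<le> dist (transform x m q) (transform x m t) + dist (transform x m q) (transform x n q) + dist (transform x n q) (transform x n t)"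
        using dist_triangle[of "transform x m t" "transform x n t" "transform x m q"] dist_triangle[of "transform x m q" "transform x n t" "transform x n q"]
        by (simp add: dist_commute)
      then show "dist (transform x m t) (transform x n t) < e"
        using N[OF \<open>m \<ge> N\<close> \<open>n \<ge> N\<close>] lip[of m q t] lip[of n q t] tq by (simp add: dist_norm)
    qed
  qed
  then have "\<exists>l. (\<lambda>n. transform x n t) \<longlonglongrightarrow> l" for t
    using Cauchy_convergent_iff convergent_def by blast
  then obtain h where h: "\<And>t. (\<lambda>n. transform x n t) \<longlonglongrightarrow> h t" by metis
  have h_eq: "h q = h0 q" if "q \<in> \<rat>" for q
    using LIMSEQ_unique h h0 that by blast
  have hlip: "norm (h s - h t) \<le> K * \<bar>s - t\<bar>" for s t
    by (rule tendsto_upperbound[OF tendsto_norm[OF tendsto_diff[OF h h]]]) (auto simp: lip)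
  have bound: "norm (h t) \<le> C * (1 + \<bar>t\<bar>) powr - \<sigma>" for t
  proof -
    have "isCont h s" for s
    proof -
      have "((\<lambda>t. K * \<bar>t - s\<bar>) \<longlongrightarrow> 0) (at s)" by (auto intro!: tendsto_eq_intros)
      then have "((\<lambda>t. h t - h s) \<longlongrightarrow> 0) (at s)"
        by (rule Lim_null_comparison[rotated]) (auto intro!: always_eventually hlip)
      then show ?thesis by (simp add: isCont_def LIM_zero_iff)
    qed
    then have "continuous_on UNIV (\<lambda>t. norm (h t) - C * (1 + \<bar>t\<bar>) powr - \<sigma>)"
      by (intro continuous_intros continuous_at_imp_continuous_on ballI) auto
    then have "norm (h t) - C * (1 + \<bar>t\<bar>) powr - \<sigma> \<le> 0"
      using continuous_le_on_closure[of "\<rat>" "\<lambda>t. norm (h t) - C * (1 + \<bar>t\<bar>) powr - \<sigma>" t 0] C h_eq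
      by (simp add: Rats_closure_real)
    then show ?thesis by simp
  qed
  show thesis by (rule that[OF h bound])
qed

text \<open>
  The density vanishes off \<open>[0,1]\<close> because the masses sit in \<open>[0,1]\<close> and the Gaussian mollifier is
  concentrated near the origin. Continuity, and this is where integrability of the transform is used,
  extends this to the endpoints.
\<close>

lemma cascade_density:
  assumes x: "nonneg x" and dec: "decaying \<sigma> (transform x)" and "\<sigma> > 1"
  obtains f g where "uniform_limit UNIV g f sequentially" "\<And>y. isCont f y"
    "\<And>r y. r > 0 \<Longrightarrow> (\<lambda>n. real r * mollified x n (real r) y) \<longlonglongrightarrow> g r y"
    "\<And>y. y \<le> 0 \<or> 1 \<le> y \<Longrightarrow> f y = 0"
proof -
  obtain h C where h: "\<And>t. (\<lambda>n. transform x n t) \<longlonglongrightarrow> h t" "\<And>t. norm (h t) \<le> C * (1 + \<bar>t\<bar>) powr - \<sigma>"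
    by (rule decaying_imp_all_real[OF x dec]) (rule that; assumption)
  note G = gaussian_mollification_uniform_limit[OF finite_generation weight_nonneg[OF x generation_tree]
      h(1)[unfolded transform_def] h(2) \<open>\<sigma> > 1\<close>, folded mollified_def]
  obtain f g where unif: "uniform_limit UNIV g f sequentially" and cont: "\<And>y. isCont f y"
    and lim: "\<And>r y. r > 0 \<Longrightarrow> (\<lambda>n. real r * mollified x n (real r) y) \<longlonglongrightarrow> g r y"
    by (rule G, assumption) (rule that; assumption)
  obtain K where K: "K > 0" "\<And>n. Re (transform x n 0) \<le> K" using mass_bounded[OF dec] by blast
  have outside: "f y = 0" if y: "y < 0 \<or> 1 < y" for y
  proof -
    obtain \<delta> where \<delta>: "\<delta> > 0" "\<And>u. u \<in> tree B \<Longrightarrow> \<delta> \<le> \<bar>y - pos u\<bar>"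
    proof (cases "y < 0")
      case True
      then show thesis using that[of "- y"] pos_bounds(1) by force
    next
      case False
      then show thesis using that[of "y - 1"] pos_bounds(2) y by force
    qed
    have bound: "0 \<le> g r y \<and> g r y \<le> 2 * K / \<delta>\<^sup>2 * (1 / real r)" if r: "r > 0" for r
    proof -
      have e: "exp (- ((real r * (y - pos u))\<^sup>2) / 2) \<le> 2 / (real r * \<delta>)\<^sup>2" if u: "u \<in> generation B n" for u n
      proof -
        have "(real r * \<delta>)\<^sup>2 \<le> (real r * \<bar>y - pos u\<bar>)\<^sup>2"
          using r \<delta> generation_tree[OF u] by (intro power_mono mult_left_mono) auto
        then have le: "(real r * \<delta>)\<^sup>2 / 2 \<le> (real r * (y - pos u))\<^sup>2 / 2" by (simp add: power_mult_distrib)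
        have "(real r * \<delta>)\<^sup>2 / 2 \<le> exp ((real r * (y - pos u))\<^sup>2 / 2)"
          using exp_ge_add_one_self[of "(real r * (y - pos u))\<^sup>2 / 2"] le by linarith
        then have "inverse (exp ((real r * (y - pos u))\<^sup>2 / 2)) \<le> inverse ((real r * \<delta>)\<^sup>2 / 2)"
          using r \<delta> by (intro le_imp_inverse_le) auto
        then show ?thesis by (simp add: exp_minus inverse_eq_divide)
      qed
      have "0 \<le> real r * mollified x n (real r) y \<and> real r * mollified x n (real r) y \<le> 2 * K / \<delta>\<^sup>2 * (1 / real r)" for n
      proof
        show "0 \<le> real r * mollified x n (real r) y"
          unfolding mollified_def using weight_nonneg[OF x generation_tree]
          by (intro mult_nonneg_nonneg sum_nonneg) auto
        have "mollified x n (real r) y \<le> (\<Sum>u\<in>generation B n. weight x u * (2 / (real r * \<delta>)\<^sup>2))"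
          unfolding mollified_def using e weight_nonneg[OF x generation_tree]
          by (intro sum_mono mult_left_mono) auto
        also have "\<dots> = Re (transform x n 0) * (2 / (real r * \<delta>)\<^sup>2)"
          by (simp add: transform_def sum_distrib_right sum_divide_distrib)
        also have "\<dots> \<le> K * (2 / (real r * \<delta>)\<^sup>2)"
          by (intro mult_right_mono K) auto
        finally show "real r * mollified x n (real r) y \<le> 2 * K / \<delta>\<^sup>2 * (1 / real r)"
          using r \<delta> by (simp add: field_simps power2_eq_square)
      qed
      then show ?thesis
        using LIMSEQ_le_const[OF lim[OF r, of y]] LIMSEQ_le_const2[OF lim[OF r, of y]] by simp
    qed
    have "(\<lambda>r. 2 * K / \<delta>\<^sup>2 * (1 / real r)) \<longlonglongrightarrow> 0"
      using tendsto_mult_left[OF lim_const_over_n[of 1], of "2 * K / \<delta>\<^sup>2"] by simp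
    moreover have "\<forall>\<^sub>F r in sequentially. norm (g r y) \<le> 2 * K / \<delta>\<^sup>2 * (1 / real r)"
      using eventually_gt_at_top[of 0] by eventually_elim (use bound in auto)
    ultimately have "(\<lambda>r. g r y) \<longlonglongrightarrow> 0" by (rule Lim_null_comparison[rotated])
    moreover have "(\<lambda>r. g r y) \<longlonglongrightarrow> f y" by (rule tendsto_uniform_limitI[OF unif]) simp
    ultimately show ?thesis using LIMSEQ_unique by blast
  qed
  have c: "continuous_on S f" for S by (simp add: cont continuous_at_imp_continuous_on)
  have "f y = 0" if "y \<le> 0" for y
    using continuous_constant_on_closure[OF c[of "closure {..<0}"], of 0 y] outside that by auto
  moreover have "f y = 0" if "1 \<le> y" for y
    using continuous_constant_on_closure[OF c[of "closure {1<..}"], of 0 y] outside that by auto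
  ultimately show thesis using that[OF unif cont lim] by blast
qed

text \<open>
  The density of the whole cascade vanishes at \<open>k / b ^ m\<close>, because after rescaling
  this point is an integer for every cube of generation \<open>m\<close>, where the density of the subcascade
  vanishes. So the density is zero everywhere. The mass is then recovered by covering \<open>[0,1]\<close> with
  the \<open>r + 1\<close> Gaussians of width \<open>1 / r\<close> centred at \<open>k / r\<close>: it is at most a constant times the average of
  the mollified masses at these points, which tends to \<open>0\<close> uniformly.
\<close>

lemma all_decaying_imp_mass_zero:
  assumes x: "nonneg x" and dec: "\<And>u. u \<in> tree B \<Longrightarrow> decaying \<sigma> (transform (shifted x u))" and "\<sigma> > 1"
  shows "(\<lambda>n. transform x n 0) \<longlonglongrightarrow> 0"
proof -
  define P where "P u f g \<longleftrightarrow> uniform_limit UNIV g f sequentially \<and> (\<forall>y. isCont f y) \<and>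
    (\<forall>r>0. \<forall>y. (\<lambda>n. real r * mollified (shifted x u) n (real r) y) \<longlonglongrightarrow> g r y) \<and>
    (\<forall>y. y \<le> 0 \<or> 1 \<le> y \<longrightarrow> f y = 0)" for u f g
  have "\<exists>f g. P u f g" if "u \<in> tree B" for u
    unfolding P_def by (rule cascade_density[OF nonneg_sub[OF x that] dec[OF that] \<open>\<sigma> > 1\<close>]) blast
  then obtain f g where "\<And>u. u \<in> tree B \<Longrightarrow> P u (f u) (g u)" by metis
  then have unif: "\<And>u. u \<in> tree B \<Longrightarrow> uniform_limit UNIV (g u) (f u) sequentially"
    and cont: "\<And>u y. u \<in> tree B \<Longrightarrow> isCont (f u) y"
    and lim: "\<And>u r y. u \<in> tree B \<Longrightarrow> r > 0 \<Longrightarrow> (\<lambda>n. real r * mollified (shifted x u) n (real r) y) \<longlonglongrightarrow> g u r y"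
    and outside: "\<And>u y. u \<in> tree B \<Longrightarrow> y \<le> 0 \<or> 1 \<le> y \<Longrightarrow> f u y = 0"
    unfolding P_def by blast+
  have root: "[] \<in> tree B" by (simp add: tree_def)
  have shifted_Nil: "shifted x [] = x" by (simp add: shifted_def)
  have badic: "f [] (real_of_int k / real b ^ m) = 0" for k m
  proof -
    define y where "y = real_of_int k / real b ^ m"
    define z where "z u = real b ^ m * (y - pos u)" for u
    \<comment> \<open>mollifying the whole at scale \<open>b ^ m * r\<close> is mollifying the pieces at scale \<open>r\<close>\<close>
    have g_rec: "g [] (b ^ m * r) y = real b ^ m * (\<Sum>u\<in>generation B m. weight x u * g u r (z u))" if r: "r > 0" for r
    proof -
      have "b ^ m * r > 0" using r b by simp
      from LIMSEQ_ignore_initial_segment[OF lim[OF root this, of y], of m]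
      have "(\<lambda>n. real b ^ m * (real r * mollified x (m + n) (real b ^ m * real r) y)) \<longlonglongrightarrow> g [] (b ^ m * r) y"
        by (simp add: shifted_Nil add.commute mult.assoc)
      then have 1: "(\<lambda>n. real b ^ m * (\<Sum>u\<in>generation B m. weight x u * (real r * mollified (shifted x u) n (real r) (z u)))) \<longlonglongrightarrow> g [] (b ^ m * r) y"
        by (simp add: mollified_add z_def sum_distrib_left mult.left_commute)
      have 2: "(\<lambda>n. real b ^ m * (\<Sum>u\<in>generation B m. weight x u * (real r * mollified (shifted x u) n (real r) (z u))))
         \<longlonglongrightarrow> real b ^ m * (\<Sum>u\<in>generation B m. weight x u * g u r (z u))"
        by (intro tendsto_intros lim generation_tree r)
      show ?thesis by (rule LIMSEQ_unique[OF 1 2])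
    qed
    have z0: "f u (z u) = 0" if u: "u \<in> generation B m" for u
    proof -
      obtain l where "pos u = real l / real b ^ m"
        using pos_badic[OF generation_tree[OF u]] generation_length[OF u] by metis
      then have "z u = real_of_int (k - int l)"
        using b_pos by (simp add: z_def y_def field_simps)
      moreover have "k - int l \<le> 0 \<or> 1 \<le> k - int l" by linarith
      ultimately have "z u \<le> 0 \<or> 1 \<le> z u" by (metis of_int_le_0_iff of_int_1_le_iff)
      then show ?thesis by (rule outside[OF generation_tree[OF u]])
    qed
    have "(\<lambda>r. real b ^ m * (\<Sum>u\<in>generation B m. weight x u * g u r (z u)))
        \<longlonglongrightarrow> real b ^ m * (\<Sum>u\<in>generation B m. weight x u * f u (z u))"
      by (intro tendsto_intros tendsto_uniform_limitI[OF unif] generation_tree) auto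
    then have "(\<lambda>r. real b ^ m * (\<Sum>u\<in>generation B m. weight x u * g u r (z u))) \<longlonglongrightarrow> 0"
      by (simp add: z0)
    then have "(\<lambda>r. g [] (b ^ m * r) y) \<longlonglongrightarrow> 0"
      by (rule Lim_transform_eventually) (auto intro!: eventually_mono[OF eventually_gt_at_top[of 0]] simp: g_rec)
    moreover have "(\<lambda>r. g [] (b ^ m * r) y) \<longlonglongrightarrow> f [] y"
    proof -
      have "strict_mono (\<lambda>r. b ^ m * r)" using b by (auto simp: strict_mono_def)
      from LIMSEQ_subseq_LIMSEQ[OF tendsto_uniform_limitI[OF unif[OF root], of y] this]
      show ?thesis by (simp add: o_def)
    qed
    ultimately show ?thesis using LIMSEQ_unique y_def by blast
  qed
  have f0: "f [] y = 0" for y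
  proof -
    define q where "q m = real_of_int \<lfloor>y * real b ^ m\<rfloor> / real b ^ m" for m
    have "\<bar>q m - y\<bar> \<le> (1 / real b) ^ m" for m
    proof -
      have bm: "real b ^ m > 0" using b_pos by simp
      have fl: "\<bar>real_of_int \<lfloor>z\<rfloor> - z\<bar> \<le> 1" for z :: real by linarith
      have "q m - y = (real_of_int \<lfloor>y * real b ^ m\<rfloor> - y * real b ^ m) / real b ^ m"
        using bm by (simp add: q_def field_simps)
      also have "\<bar>\<dots>\<bar> \<le> 1 / real b ^ m"
        unfolding abs_divide using bm fl by (intro frac_le) auto
      finally show ?thesis by (simp add: power_divide)
    qed
    moreover have "(\<lambda>m. (1 / real b) ^ m) \<longlonglongrightarrow> 0" using b by (intro LIMSEQ_realpow_zero) auto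
    ultimately have "(\<lambda>m. q m - y) \<longlonglongrightarrow> 0"
      by (intro Lim_null_comparison[of "\<lambda>m. q m - y"]) auto
    then have "q \<longlonglongrightarrow> y" by (simp add: LIM_zero_iff)
    then have "(\<lambda>m. f [] (q m)) \<longlonglongrightarrow> f [] y" using cont[OF root] by (rule isCont_tendsto_compose[rotated])
    then show ?thesis using badic by (simp add: q_def LIMSEQ_const_iff)
  qed
  obtain h where h: "(\<lambda>n. transform x n 0) \<longlonglongrightarrow> h"
    using dec[OF root] unfolding decaying_def shifted_Nil by (meson Rats_0)
  have mass: "Re (transform x n 0) = (\<Sum>u\<in>generation B n. weight x u)" for n by (simp add: transform_def)
  have small: "Re h \<le> 2 * exp (1/2) * e" if "e > 0" for e
  proof -
    have "\<forall>\<^sub>F r in sequentially. \<forall>y\<in>UNIV. dist (g [] r y) (f [] y) < e"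
      using unif[OF root] \<open>e > 0\<close> unfolding uniform_limit_iff by blast
    then obtain r where r: "r > 0" "\<And>y. \<bar>g [] r y\<bar> < e"
      using eventually_happens[OF eventually_conj[OF _ eventually_gt_at_top[of 0]]]
      by (auto simp: f0 dist_real_def)
    \<comment> \<open>some \<open>k / r\<close> lies within \<open>1 / r\<close> of \<open>pos u\<close>, and its Gaussian is at least \<open>exp (- 1 / 2)\<close> there\<close>
    have cover: "1 \<le> exp (1/2) * (\<Sum>k\<le>r. exp (- ((real r * (real k / real r - pos u))\<^sup>2) / 2))"
      if u: "u \<in> generation B n" for u n
    proof -
      define k where "k = nat \<lfloor>real r * pos u\<rfloor>"
      have p: "0 \<le> pos u" "pos u \<le> 1" using pos_bounds generation_tree[OF u] by auto
      have p0: "0 \<le> real r * pos u" using p by simp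
      have p1: "real r * pos u \<le> real r" using p by (simp add: mult_left_le)
      have k: "real k \<le> real r * pos u" "real r * pos u \<le> real k + 1"
        using p0 unfolding k_def by linarith+
      then have "k \<le> r" using p1 by linarith
      have "\<bar>real r * (real k / real r - pos u)\<bar> \<le> 1"
        using r k by (simp add: right_diff_distrib)
      then have "(real r * (real k / real r - pos u))\<^sup>2 \<le> 1" by (rule abs_le_square_iff[THEN iffD1, of _ 1, simplified, unfolded power_one])
      then have "exp (- (1/2)) \<le> exp (- ((real r * (real k / real r - pos u))\<^sup>2) / 2)" by simp
      also have "\<dots> \<le> (\<Sum>k\<le>r. exp (- ((real r * (real k / real r - pos u))\<^sup>2) / 2))"
        using \<open>k \<le> r\<close> by (intro member_le_sum) auto
      finally have "exp (1/2) * exp (- (1/2)) \<le> exp (1/2) * (\<Sum>k\<le>r. exp (- ((real r * (real k / real r - pos u))\<^sup>2) / 2))"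
        by (intro mult_left_mono) auto
      then show ?thesis by (simp add: exp_minus)
    qed
    have "Re (transform x n 0) \<le> exp (1/2) / real r * (\<Sum>k\<le>r. real r * mollified x n (real r) (real k / real r))" for n
    proof -
      have "Re (transform x n 0) = (\<Sum>u\<in>generation B n. weight x u * 1)" by (simp add: mass)
      also have "\<dots> \<le> (\<Sum>u\<in>generation B n. weight x u *
           (exp (1/2) * (\<Sum>k\<le>r. exp (- ((real r * (real k / real r - pos u))\<^sup>2) / 2))))"
        using weight_nonneg[OF x generation_tree] by (intro sum_mono mult_left_mono cover) auto
      also have "\<dots> = exp (1/2) * (\<Sum>k\<le>r. mollified x n (real r) (real k / real r))"
        unfolding mollified_def sum_distrib_left
        by (subst sum.swap) (intro sum.cong refl, simp)
      finally show ?thesis using r by (simp add: sum_distrib_left[symmetric])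
    qed
    moreover have "(\<lambda>n. exp (1/2) / real r * (\<Sum>k\<le>r. real r * mollified x n (real r) (real k / real r)))
       \<longlonglongrightarrow> exp (1/2) / real r * (\<Sum>k\<le>r. g [] r (real k / real r))"
      using lim[OF root r(1)] unfolding shifted_Nil by (intro tendsto_intros)
    ultimately have "Re h \<le> exp (1/2) / real r * (\<Sum>k\<le>r. g [] r (real k / real r))"
      using tendsto_Re[OF h] by (meson LIMSEQ_le)
    also have "\<dots> \<le> exp (1/2) / real r * (\<Sum>k\<le>r. e)"
      using r by (intro mult_left_mono sum_mono) (auto intro: less_imp_le abs_le_D1)
    also have "\<dots> = exp (1/2) * e * ((real r + 1) / real r)" by simp
    also have "\<dots> \<le> exp (1/2) * e * 2" using r \<open>e > 0\<close> by (intro mult_left_mono) (auto simp: field_simps)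
    finally show ?thesis by (simp add: mult_ac)
  qed
  have "Re h \<le> 0"
  proof (rule field_le_epsilon)
    fix e :: real assume "e > 0"
    then show "Re h \<le> 0 + e" using small[of "e / (2 * exp (1/2))"] by simp
  qed
  moreover have "0 \<le> Re h"
    by (rule LIMSEQ_le_const[OF tendsto_Re[OF h]]) (auto simp: mass intro!: sum_nonneg weight_nonneg[OF x generation_tree])
  moreover have "Im h = 0"
    using LIMSEQ_unique[OF tendsto_Im[OF h], of 0] by (simp add: transform_def)
  ultimately have "h = 0" by (simp add: complex_eq_iff)
  then show ?thesis using h by simp
qed

end

section \<open>Two facts on product measures\<close>

text \<open>
  The sets that can be approximated form a \<open>\<sigma>\<close>-algebra that contains the cylinders: a countable union is, up to
  small measure, a finite one. Instead of a set in a finite product, the approximating set is described by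
  invariance under changes outside finitely many coordinates.
\<close>

lemma PiM_finite_coordinates_approx:
  fixes I :: "'i set" and N :: "'i \<Rightarrow> 'a measure"
  assumes N: "\<And>i. prob_space (N i)" and A: "A \<in> sets (PiM I N)" and "e > 0"
  obtains A' J where "A' \<in> sets (PiM I N)" "finite J" "J \<subseteq> I"
    "\<And>x y. x \<in> A' \<Longrightarrow> y \<in> space (PiM I N) \<Longrightarrow> (\<And>i. i \<in> J \<Longrightarrow> y i = x i) \<Longrightarrow> y \<in> A'"
    "measure (PiM I N) (sym_diff A A') < e"
proof -
  interpret P: prob_space "PiM I N" by (rule prob_space_PiM) (rule N)
  define cyl where "cyl A' J \<longleftrightarrow> A' \<in> sets (PiM I N) \<and> finite J \<and> J \<subseteq> I \<and>
    (\<forall>x\<in>A'. \<forall>y\<in>space (PiM I N). (\<forall>i\<in>J. y i = x i) \<longrightarrow> y \<in> A')" for A' J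
  have "A \<in> sigma_sets (\<Pi>\<^sub>E i\<in>I. space (N i))
      {{f\<in>\<Pi>\<^sub>E i\<in>I. space (N i). f i \<in> A} | i A. i \<in> I \<and> A \<in> sets (N i)}"
    using A by (simp only: sets_PiM_single)
  then have "\<forall>e>0. \<exists>A' J. cyl A' J \<and> P.prob (sym_diff A A') < e"
  proof induction
    case (Basic A)
    then obtain i E where i: "i \<in> I" "E \<in> sets (N i)" "A = {f\<in>\<Pi>\<^sub>E i\<in>I. space (N i). f i \<in> E}" by blast
    have "A = {f\<in>space (PiM I N). f i \<in> E}" using i by (simp add: space_PiM)
    moreover have "\<dots> \<in> sets (PiM I N)" using i(1,2) by measurable
    ultimately have "cyl A {i}" using i by (auto simp: cyl_def)
    then show ?case by (intro allI impI exI[of _ A] exI[of _ "{i}"]) simp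
  next
    case Empty
    have "cyl {} {}" by (simp add: cyl_def)
    then show ?case by (intro allI impI exI[of _ "{}"]) simp
  next
    case (Compl A)
    have A_sub: "A \<subseteq> space (PiM I N)"
      using sigma_sets_into_sp[OF _ Compl.hyps] by (auto simp: space_PiM)
    show ?case
    proof (intro allI impI)
      fix e :: real assume "e > 0"
      then obtain A' J where A': "cyl A' J" "P.prob (sym_diff A A') < e" using Compl.IH by blast
      have "A' \<subseteq> space (PiM I N)" using A' sets.sets_into_space by (auto simp: cyl_def)
      then have "sym_diff ((\<Pi>\<^sub>E i\<in>I. space (N i)) - A) (space (PiM I N) - A') = sym_diff A A'"
        using A_sub by (auto simp: space_PiM)
      moreover have "cyl (space (PiM I N) - A') J"
        using A'(1) unfolding cyl_def by (auto; metis)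
      ultimately show "\<exists>A' J. cyl A' J \<and> P.prob (sym_diff ((\<Pi>\<^sub>E i\<in>I. space (N i)) - A) A') < e"
        using A'(2) by metis
    qed
  next
    case (Union A)
    have A_sets[measurable]: "A i \<in> sets (PiM I N)" for i
      using Union.hyps by (simp only: sets_PiM_single)
    show ?case
    proof (intro allI impI)
      fix e :: real assume "e > 0"
      have "(\<lambda>n. P.prob (\<Union>i<n. A i)) \<longlonglongrightarrow> P.prob (\<Union>n. \<Union>i<n. A i)"
        using A_sets by (intro P.finite_Lim_measure_incseq) (auto intro!: monoI intro: less_le_trans)
      moreover have "(\<Union>n. \<Union>i<n. A i) = (\<Union>i. A i)" by blast
      ultimately have "\<forall>\<^sub>F n in sequentially. P.prob (\<Union>i. A i) - e / 2 < P.prob (\<Union>i<n. A i)"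
        using \<open>e > 0\<close> by (intro order_tendstoD) auto
      then obtain n where n: "P.prob (\<Union>i. A i) - e / 2 < P.prob (\<Union>i<n. A i)"
        using eventually_happens by force
      have rest: "P.prob ((\<Union>i. A i) - (\<Union>i<n. A i)) < e / 2"
        using n A_sets by (subst P.finite_measure_Diff) auto
      have "\<exists>A' J. cyl A' J \<and> P.prob (sym_diff (A i) A') < e / (2 * real (Suc n))" for i
        using Union.IH[of i] \<open>e > 0\<close> by simp
      then obtain A' J where A': "\<And>i. cyl (A' i) (J i)"
          "\<And>i. P.prob (sym_diff (A i) (A' i)) < e / (2 * real (Suc n))" by metis
      have A'_sets[measurable]: "A' i \<in> sets (PiM I N)" for i using A'(1) by (simp add: cyl_def)
      have "cyl (\<Union>i<n. A' i) (\<Union>i<n. J i)"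
        unfolding cyl_def
      proof (intro conjI ballI impI)
        fix x y assume x: "x \<in> (\<Union>i<n. A' i)" and y: "y \<in> space (PiM I N)" "\<forall>i\<in>\<Union>i<n. J i. y i = x i"
        then obtain i where "i < n" "x \<in> A' i" by blast
        then show "y \<in> (\<Union>i<n. A' i)" using A'(1)[of i] y unfolding cyl_def by blast
      qed (use A'(1) A'_sets in \<open>auto simp: cyl_def\<close>)
      moreover have "P.prob (sym_diff (\<Union>i. A i) (\<Union>i<n. A' i)) < e"
      proof -
        have sub: "sym_diff (\<Union>i. A i) (\<Union>i<n. A' i)
            \<subseteq> ((\<Union>i. A i) - (\<Union>i<n. A i)) \<union> (\<Union>i<n. sym_diff (A i) (A' i))"
        proof
          fix x assume x: "x \<in> sym_diff (\<Union>i. A i) (\<Union>i<n. A' i)"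
          show "x \<in> ((\<Union>i. A i) - (\<Union>i<n. A i)) \<union> (\<Union>i<n. sym_diff (A i) (A' i))"
          proof (cases "\<exists>i<n. x \<in> sym_diff (A i) (A' i)")
            case True
            then show ?thesis by blast
          next
            case False
            then have "\<forall>i<n. x \<in> A i \<longleftrightarrow> x \<in> A' i" by blast
            then show ?thesis using x by blast
          qed
        qed
        have "P.prob (sym_diff (\<Union>i. A i) (\<Union>i<n. A' i))
            \<le> P.prob (((\<Union>i. A i) - (\<Union>i<n. A i)) \<union> (\<Union>i<n. sym_diff (A i) (A' i)))"
          by (intro P.finite_measure_mono sub) measurable
        also have "\<dots> \<le> P.prob ((\<Union>i. A i) - (\<Union>i<n. A i)) + P.prob (\<Union>i<n. sym_diff (A i) (A' i))"
          using A_sets A'_sets by (intro measure_Un_le) auto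
        also have "P.prob (\<Union>i<n. sym_diff (A i) (A' i)) \<le> (\<Sum>i<n. P.prob (sym_diff (A i) (A' i)))"
          using A_sets A'_sets by (intro P.finite_measure_subadditive_finite) auto
        also have "\<dots> \<le> (\<Sum>i<n. e / (2 * real (Suc n)))"
          using A'(2) by (intro sum_mono less_imp_le)
        also have "\<dots> \<le> e / 2" using \<open>e > 0\<close> by (simp add: field_simps)
        finally show ?thesis using rest by linarith
      qed
      ultimately show "\<exists>A' J. cyl A' J \<and> P.prob (sym_diff (\<Union> (range A)) A') < e" by blast
    qed
  qed
  then obtain A' J where "cyl A' J" "P.prob (sym_diff A A') < e" using \<open>e > 0\<close> by blast
  then show thesis by (intro that[of A' J]) (auto simp: cyl_def)
qed

text \<open>
  Replacing the coordinates in \<open>K\<close> by distinct coordinates of an independent copy preserves the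
  law; below, \<open>K\<close> is a subtree and \<open>s\<close> identifies it with the whole tree.
\<close>

lemma distr_PiM_resample:
  fixes I K :: "'i set" and s :: "'i \<Rightarrow> 'i" and D :: "'a measure"
  assumes D: "prob_space D" and s: "inj_on s K" "s ` K \<subseteq> I"
  defines "P \<equiv> PiM I (\<lambda>_. D)"
  shows "distr (P \<Otimes>\<^sub>M P) P (\<lambda>(y, z). \<lambda>v\<in>I. if v \<in> K then z (s v) else y v) = P"
proof -
  interpret D: prob_space D by fact
  interpret PP: product_prob_space "\<lambda>_. D" I by standard
  interpret P: prob_space P unfolding P_def by (rule prob_space_PiM) (rule D)
  define T where "T = (\<lambda>(y, z). \<lambda>v\<in>I. if v \<in> K then z (s v) else (y v :: 'a))"
  have T_meas[measurable]: "T \<in> P \<Otimes>\<^sub>M P \<rightarrow>\<^sub>M P"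
    unfolding P_def T_def case_prod_unfold
  proof (rule measurable_restrict)
    fix v assume v: "v \<in> I"
    show "(\<lambda>p. if v \<in> K then snd p (s v) else fst p v) \<in> PiM I (\<lambda>_. D) \<Otimes>\<^sub>M PiM I (\<lambda>_. D) \<rightarrow>\<^sub>M D"
    proof (cases "v \<in> K")
      case True
      then have "s v \<in> I" using s by auto
      then show ?thesis using True
        by (auto intro!: measurable_compose[OF measurable_snd measurable_component_singleton])
    next
      case False
      then show ?thesis using v
        by (auto intro!: measurable_compose[OF measurable_fst measurable_component_singleton])
    qed
  qed
  have "distr (P \<Otimes>\<^sub>M P) P T = PiM I (\<lambda>_. D)"
  proof (rule PP.PiM_eq)
    fix J and F :: "'i \<Rightarrow> 'a set"
    assume J: "finite J" "J \<subseteq> I" and F: "\<And>j. j \<in> J \<Longrightarrow> F j \<in> sets D"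
    define Y where "Y = {y\<in>space P. \<forall>v\<in>J - K. y v \<in> F v}"
    define Z where "Z = {z\<in>space P. \<forall>w\<in>s ` (J \<inter> K). z w \<in> F (the_inv_into K s w)}"
    have inv: "the_inv_into K s (s v) = v" if "v \<in> K" for v
      using that s by (simp add: the_inv_into_f_f)
    have Y: "emeasure P Y = (\<Prod>v\<in>J - K. emeasure D (F v))"
      unfolding Y_def P_def using J F by (intro PP.emeasure_PiM_Collect) auto
    have "emeasure P Z = (\<Prod>w\<in>s ` (J \<inter> K). emeasure D (F (the_inv_into K s w)))"
      unfolding Z_def P_def using J F s by (intro PP.emeasure_PiM_Collect) (auto simp: inv)
    also have "\<dots> = (\<Prod>v\<in>J \<inter> K. emeasure D (F v))"
      using s by (subst prod.reindex) (auto intro: inj_on_subset simp: inv)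
    finally have Z: "emeasure P Z = (\<Prod>v\<in>J \<inter> K. emeasure D (F v))" .
    have emb: "prod_emb I (\<lambda>_. D) J (\<Pi>\<^sub>E j\<in>J. F j) = {x\<in>space P. \<forall>j\<in>J. x j \<in> F j}"
      unfolding P_def using J by (auto simp: prod_emb_def space_PiM)
    have "T -` {x\<in>space P. \<forall>j\<in>J. x j \<in> F j} \<inter> space (P \<Otimes>\<^sub>M P) = Y \<times> Z"
    proof -
      have Tp: "T p \<in> space P" if "p \<in> space (P \<Otimes>\<^sub>M P)" for p
        using measurable_space[OF T_meas that] .
      have TF: "(\<forall>j\<in>J. T (y, z) j \<in> F j) \<longleftrightarrow> (\<forall>v\<in>J - K. y v \<in> F v) \<and> (\<forall>v\<in>J \<inter> K. z (s v) \<in> F v)" for y z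
        using J by (auto simp: T_def)
      have "p \<in> T -` {x\<in>space P. \<forall>j\<in>J. x j \<in> F j} \<inter> space (P \<Otimes>\<^sub>M P) \<longleftrightarrow> p \<in> Y \<times> Z" for p
        using Tp[of p] by (cases p) (simp add: TF Y_def Z_def space_pair_measure inv, blast)
      then show ?thesis by blast
    qed
    moreover have "{x\<in>space P. \<forall>j\<in>J. x j \<in> F j} \<in> sets P"
      unfolding P_def by (measurable; use J F in auto)
    ultimately have "emeasure (distr (P \<Otimes>\<^sub>M P) P T) (prod_emb I (\<lambda>_. D) J (\<Pi>\<^sub>E j\<in>J. F j)) = emeasure (P \<Otimes>\<^sub>M P) (Y \<times> Z)"
      unfolding emb by (simp add: emeasure_distr)
    also have "\<dots> = emeasure P Y * emeasure P Z"
    proof (rule P.emeasure_pair_measure_Times)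
      show "Y \<in> sets P" unfolding Y_def P_def by (measurable; use J F in auto)
      show "Z \<in> sets P" unfolding Z_def P_def by (measurable; use J F s in \<open>auto simp: inv\<close>)
    qed
    also have "\<dots> = (\<Prod>j\<in>J. emeasure D (F j))"
      unfolding Y Z using prod.Int_Diff[OF J(1), of "\<lambda>j. emeasure D (F j)" K] by (simp add: mult.commute)
    finally show "emeasure (distr (P \<Otimes>\<^sub>M P) P T) (prod_emb I (\<lambda>_. D) J (\<Pi>\<^sub>E j\<in>J. F j)) = (\<Prod>j\<in>J. emeasure D (F j))" .
  qed (simp add: P_def)
  then show ?thesis by (simp add: T_def P_def)
qed

section \<open>The zero-one law for Fourier decay\<close>

lemma decaying_diff:
  assumes "decaying \<sigma> F" "decaying \<sigma> G"
  shows "decaying \<sigma> (\<lambda>n t. F n t - G n t)"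
proof -
  from assms obtain h C h' C' where
    *: "\<And>q. q \<in> \<rat> \<Longrightarrow> (\<lambda>n. F n q) \<longlonglongrightarrow> h q \<and> norm (h q) \<le> C * (1 + \<bar>q\<bar>) powr - \<sigma>"
       "\<And>q. q \<in> \<rat> \<Longrightarrow> (\<lambda>n. G n q) \<longlonglongrightarrow> h' q \<and> norm (h' q) \<le> C' * (1 + \<bar>q\<bar>) powr - \<sigma>"
    unfolding decaying_def by blast
  show ?thesis
    unfolding decaying_def
  proof (intro exI ballI conjI)
    fix q :: real assume q: "q \<in> \<rat>"
    show "(\<lambda>n. F n q - G n q) \<longlonglongrightarrow> h q - h' q" using * q by (intro tendsto_diff) auto
    show "norm (h q - h' q) \<le> (C + C') * (1 + \<bar>q\<bar>) powr - \<sigma>"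
      using *[OF q] norm_triangle_ineq4[of "h q" "h' q"] by (simp add: distrib_right)
  qed
qed

lemma decaying_shift:
  assumes "decaying \<sigma> F"
  shows "decaying \<sigma> (\<lambda>n. F (m + n))"
proof -
  have "(\<lambda>n. F (m + n) q) \<longlonglongrightarrow> l" if "(\<lambda>n. F n q) \<longlonglongrightarrow> l" for q l
    using LIMSEQ_ignore_initial_segment[OF that, of m] by (simp add: add.commute)
  then show ?thesis using assms unfolding decaying_def by meson
qed

lemma decaying_rescale:
  assumes "decaying \<sigma> F" "\<sigma> \<ge> 0" "\<beta> \<ge> (1::nat)"
  shows "decaying \<sigma> (\<lambda>n t. d * cis (p * t) * F n (real \<beta> * t))"
proof -
  from assms obtain h C where
    *: "\<And>q. q \<in> \<rat> \<Longrightarrow> (\<lambda>n. F n q) \<longlonglongrightarrow> h q \<and> norm (h q) \<le> C * (1 + \<bar>q\<bar>) powr - \<sigma>"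
    unfolding decaying_def by blast
  have "0 \<le> C" using *[of 0] norm_ge_zero[of "h 0"] by (simp del: norm_ge_zero)
  show ?thesis
    unfolding decaying_def
  proof (intro exI ballI conjI)
    fix q :: real assume "q \<in> \<rat>"
    then have q: "real \<beta> * q \<in> \<rat>" by simp
    show "(\<lambda>n. d * cis (p * q) * F n (real \<beta> * q)) \<longlonglongrightarrow> d * cis (p * q) * h (real \<beta> * q)"
      using *[OF q] by (intro tendsto_mult_left) auto
    have "1 + \<bar>q\<bar> \<le> 1 + \<bar>real \<beta> * q\<bar>"
      using mult_right_mono[of 1 "real \<beta>" "\<bar>q\<bar>"] \<open>\<beta> \<ge> 1\<close> by (simp add: abs_mult)
    then have "(1 + \<bar>real \<beta> * q\<bar>) powr - \<sigma> \<le> (1 + \<bar>q\<bar>) powr - \<sigma>"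
      using \<open>\<sigma> \<ge> 0\<close> by (intro powr_mono2') auto
    then have "norm (h (real \<beta> * q)) \<le> C * (1 + \<bar>q\<bar>) powr - \<sigma>"
      using *[OF q] mult_left_mono[OF _ \<open>0 \<le> C\<close>] by (meson order_trans)
    then show "norm (d * cis (p * q) * h (real \<beta> * q)) \<le> (norm d * C) * (1 + \<bar>q\<bar>) powr - \<sigma>"
      by (simp add: norm_mult mult.assoc mult_left_mono)
  qed
qed

text \<open>An equivalent form of decay made of countably many conditions, from which measurability is read off.\<close>

lemma decaying_iff:
  "decaying \<sigma> F \<longleftrightarrow> (\<forall>q::rat. Cauchy (\<lambda>n. F n (of_rat q))) \<and>
    (\<exists>C::nat. \<forall>q::rat. norm (lim (\<lambda>n. F n (of_rat q))) \<le> real C * (1 + \<bar>of_rat q\<bar>) powr - \<sigma>)"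
proof (intro iffI conjI)
  assume "decaying \<sigma> F"
  then obtain h C where
    *: "\<And>q. q \<in> \<rat> \<Longrightarrow> (\<lambda>n. F n q) \<longlonglongrightarrow> h q \<and> norm (h q) \<le> C * (1 + \<bar>q\<bar>) powr - \<sigma>"
    unfolding decaying_def by blast
  show "\<forall>q::rat. Cauchy (\<lambda>n. F n (of_rat q))"
    using * LIMSEQ_imp_Cauchy Rats_of_rat by blast
  have "norm (lim (\<lambda>n. F n (of_rat q))) \<le> real (nat \<lceil>C\<rceil>) * (1 + \<bar>of_rat q\<bar>) powr - \<sigma>" for q :: rat
  proof -
    have "lim (\<lambda>n. F n (of_rat q)) = h (of_rat q)" using *[OF Rats_of_rat] by (intro limI) blast
    also have "norm \<dots> \<le> C * (1 + \<bar>of_rat q\<bar>) powr - \<sigma>" using *[OF Rats_of_rat] by blast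
    also have "\<dots> \<le> real (nat \<lceil>C\<rceil>) * (1 + \<bar>of_rat q\<bar>) powr - \<sigma>"
      by (intro mult_right_mono) (auto simp: real_nat_ceiling_ge)
    finally show ?thesis .
  qed
  then show "\<exists>C::nat. \<forall>q::rat. norm (lim (\<lambda>n. F n (of_rat q))) \<le> real C * (1 + \<bar>of_rat q\<bar>) powr - \<sigma>"
    by blast
next
  assume *: "(\<forall>q::rat. Cauchy (\<lambda>n. F n (of_rat q))) \<and>
    (\<exists>C::nat. \<forall>q::rat. norm (lim (\<lambda>n. F n (of_rat q))) \<le> real C * (1 + \<bar>of_rat q\<bar>) powr - \<sigma>)"
  then obtain C :: nat where C: "\<And>q::rat. norm (lim (\<lambda>n. F n (of_rat q))) \<le> real C * (1 + \<bar>of_rat q\<bar>) powr - \<sigma>"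
    by blast
  show "decaying \<sigma> F"
    unfolding decaying_def
  proof (intro exI ballI)
    fix q :: real assume "q \<in> \<rat>"
    then obtain r :: rat where r: "q = of_rat r" by (auto elim: Rats_cases)
    then show "(\<lambda>n. F n q) \<longlonglongrightarrow> lim (\<lambda>n. F n q) \<and> norm (lim (\<lambda>n. F n q)) \<le> real C * (1 + \<bar>q\<bar>) powr - \<sigma>"
      using * C[of r] by (auto simp: convergent_LIMSEQ_iff Cauchy_convergent_iff)
  qed
qed

lemma pred_decaying:
  assumes [measurable]: "\<And>n t. (\<lambda>x. F x n t) \<in> borel_measurable M"
  shows "Measurable.pred M (\<lambda>x. decaying \<sigma> (F x))"
  unfolding decaying_iff by measurable

context projected_cascade
begin

lemma weight_cong:
  assumes "u \<in> tree B" "\<And>v. v \<in> tree B - {[]} \<Longrightarrow> length v \<le> length u \<Longrightarrow> x v = y v"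
  shows "weight x u = weight y u"
  unfolding weight_def
proof (intro arg_cong2[where f="(/)"] prod.cong refl)
  fix k assume "k \<in> {1..length u}"
  then have "take k u \<in> tree B - {[]}" using assms(1) by (auto simp: tree_def dest: in_set_takeD)
  then show "x (take k u) = y (take k u)" by (rule assms(2)) simp
qed

lemma transform_cong:
  assumes "\<And>v. v \<in> tree B - {[]} \<Longrightarrow> x v = y v"
  shows "transform x n t = transform y n t"
proof -
  have "weight x u = weight y u" if "u \<in> generation B n" for u
    using generation_tree[OF that] by (rule weight_cong) (rule assms)
  then show ?thesis by (simp add: transform_def)
qed

definition alive :: "nat \<Rightarrow> (nat list \<Rightarrow> real) \<Rightarrow> bool" where
  "alive m x \<longleftrightarrow> (\<exists>u\<in>generation B m. 0 < weight x u)"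

text \<open>If all weights of one generation vanish, so do all later ones.\<close>

lemma not_alive_imp_mass_zero:
  assumes "nonneg x" "\<not> alive m x"
  shows "(\<lambda>n. transform x n t) \<longlonglongrightarrow> 0"
proof -
  have "weight x u = 0" if "u \<in> generation B m" for u
    using assms weight_nonneg[OF assms(1) generation_tree[OF that]] that by (force simp: alive_def)
  then have "transform x (m + n) t = 0" for n by (simp add: transform_add)
  then have "(\<lambda>n. transform x (n + m) t) \<longlonglongrightarrow> 0" by (simp add: add.commute)
  then show ?thesis by (rule LIMSEQ_offset)
qed

end

text \<open>\<open>D\<close> is the common law of the weights, and \<open>P\<close> below is the law of the whole family.\<close>

locale random_projected_cascade = projected_cascade b B a + D: prob_space D
  for b B :: nat and a :: "nat \<Rightarrow> real" and D :: "real measure" +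
  assumes sets_D [measurable_cong]: "sets D = sets borel" and D_nonneg: "AE w in D. 0 \<le> w"
begin

abbreviation vertices :: "nat list set" where
  "vertices \<equiv> tree B - {[]}"

definition P :: "(nat list \<Rightarrow> real) measure" where
  "P = PiM vertices (\<lambda>_. D)"

sublocale PP: product_prob_space "\<lambda>_. D" vertices
  by standard

sublocale P: prob_space P
  unfolding P_def by (rule prob_space_PiM) (rule D.prob_space_axioms)

lemma AE_nonneg: "AE x in P. nonneg x"
  unfolding nonneg_def P_def
  by (intro AE_ball_countable' PP.AE_component D_nonneg countableI_type) auto

lemma measurable_label: "u \<in> vertices \<Longrightarrow> (\<lambda>x. x u) \<in> borel_measurable P"
  unfolding P_def using measurable_component_singleton[of u vertices "\<lambda>_. D"]
  by (simp add: measurable_cong_sets[OF refl sets_D])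

lemma measurable_weight:
  assumes "u \<in> tree B"
  shows "(\<lambda>x. weight x u) \<in> borel_measurable P"
  unfolding weight_def
proof (intro borel_measurable_divide borel_measurable_prod borel_measurable_const)
  fix k assume "k \<in> {1..length u}"
  then show "(\<lambda>x. x (take k u)) \<in> borel_measurable P"
    using assms by (intro measurable_label) (auto simp: tree_def dest: in_set_takeD)
qed

lemma measurable_transform [measurable]: "(\<lambda>x. transform x n t) \<in> borel_measurable P"
  unfolding transform_def
  by (intro borel_measurable_sum borel_measurable_times borel_measurable_const
      measurable_compose[OF measurable_weight[OF generation_tree] borel_measurable_of_real])

lemma decaying_sets: "{x\<in>space P. decaying \<sigma> (\<lambda>n t. transform x n t - k n t)} \<in> sets P"
  using pred_decaying[of "\<lambda>x n t. transform x n t - k n t" P \<sigma>] by simp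

lemma distr_sub:
  assumes "u \<in> tree B"
  shows "distr P P (\<lambda>x. \<lambda>v\<in>vertices. x (u @ v)) = P"
  unfolding P_def using assms
  by (intro distr_PiM_reindex D.prob_space_axioms) (auto simp: tree_append inj_on_def)

lemma AE_decaying_sub:
  assumes "AE x in P. decaying \<sigma> (transform x)" "u \<in> tree B"
  shows "AE x in P. decaying \<sigma> (transform (shifted x u))"
proof -
  have "(\<lambda>x. \<lambda>v\<in>vertices. x (u @ v)) \<in> P \<rightarrow>\<^sub>M P"
    unfolding P_def using assms(2) by (intro measurable_restrict measurable_component_singleton) (auto simp: tree_append)
  moreover have "AE x in distr P P (\<lambda>x. \<lambda>v\<in>vertices. x (u @ v)). decaying \<sigma> (transform x)"
    unfolding distr_sub[OF assms(2)] by (rule assms(1))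
  ultimately have "AE x in P. decaying \<sigma> (transform (\<lambda>v\<in>vertices. x (u @ v)))"
    using pred_decaying[of "\<lambda>x. transform x" P \<sigma>] by (subst (asm) AE_distr_iff) auto
  moreover have "transform (\<lambda>v\<in>vertices. x (u @ v)) = transform (shifted x u)" for x
    by (intro ext transform_cong) (simp add: shifted_def)
  ultimately show ?thesis by simp
qed

end

context projected_cascade
begin

text \<open>
  Here \<open>x\<close> is \<open>y\<close> with the subtree below \<open>u\<close> replaced by \<open>z\<close>. In the decomposition of the transform of \<open>x\<close>
  along generation \<open>m\<close>, only the summand of \<open>u\<close> depends on \<open>z\<close>; its coefficient is not zero, so one can
  divide by it and collect the remaining summands in \<open>k\<close>, which does not depend on \<open>z\<close>.
\<close>

lemma decaying_resampled_subtree: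
  assumes "\<sigma> \<ge> 0" and u: "u \<in> generation B m" and w: "weight y u > 0"
  shows "\<exists>k. \<forall>x z. decaying \<sigma> (transform x) \<and> (\<forall>v\<in>tree B - {[]}. x (u @ v) = z v) \<and>
      (\<forall>v\<in>tree B - {[]}. v \<notin> (@) u ` (tree B - {[]}) \<longrightarrow> x v = y v) \<longrightarrow>
      decaying \<sigma> (\<lambda>n t. transform z n t - k n t)"
proof -
  define c where "c t = cis (- (real b ^ m * pos u) * t) / of_real (weight y u)" for t
  define k where "k n t = - c t * (\<Sum>u'\<in>generation B m - {u}. of_real (weight y u') *
    cis (real b ^ m * t * pos u') * transform (shifted y u') n t)" for n t
  have "decaying \<sigma> (\<lambda>n t. transform z n t - k n t)"
    if dec: "decaying \<sigma> (transform x)"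
      and xz: "\<And>v. v \<in> tree B - {[]} \<Longrightarrow> x (u @ v) = z v"
      and xy: "\<And>v. v \<in> tree B - {[]} \<Longrightarrow> v \<notin> (@) u ` (tree B - {[]}) \<Longrightarrow> x v = y v"
    for x z
  proof -
    have wxy: "weight x u' = weight y u'" if u': "u' \<in> generation B m" for u'
      using generation_tree[OF u']
    proof (rule weight_cong)
      fix v assume v: "v \<in> tree B - {[]}" "length v \<le> length u'"
      then have "v \<notin> (@) u ` (tree B - {[]})" using u u' by (auto simp: generation_length)
      with v show "x v = y v" by (intro xy)
    qed
    have other: "transform (shifted x u') n t = transform (shifted y u') n t" if u': "u' \<in> generation B m - {u}" for u' n t
    proof (rule transform_cong)
      fix v assume v: "v \<in> tree B - {[]}"
      have "u' @ v \<notin> (@) u ` (tree B - {[]})" using u u' by (auto simp: generation_length append_eq_append_conv)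
      moreover have "u' @ v \<in> tree B - {[]}" using v u' by (auto simp: tree_append generation_tree)
      ultimately show "shifted x u' v = shifted y u' v" unfolding shifted_def by (intro xy)
    qed
    have this_one: "transform (shifted x u) n t = transform z n t" for n t
      by (rule transform_cong) (simp add: shifted_def xz)
    have "c t * transform x (m + n) (real b ^ m * t) = transform z n t - k n t" for n t
    proof -
      have bm: "real b ^ m * t / real b ^ m = t" using b_pos by simp
      have "transform x (m + n) (real b ^ m * t)
        = (\<Sum>u'\<in>generation B m. of_real (weight y u') * cis (real b ^ m * t * pos u') * transform (shifted x u') n t)"
        unfolding transform_add bm by (intro sum.cong refl) (simp add: wxy)
      also have "\<dots> = of_real (weight y u) * cis (real b ^ m * t * pos u) * transform z n t
        + (\<Sum>u'\<in>generation B m - {u}. of_real (weight y u') * cis (real b ^ m * t * pos u') * transform (shifted y u') n t)"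
        by (subst sum.remove[OF finite_generation u]) (simp add: this_one other)
      finally have "c t * transform x (m + n) (real b ^ m * t)
        = c t * (of_real (weight y u) * cis (real b ^ m * t * pos u)) * transform z n t - k n t"
        by (simp add: k_def distrib_left mult.assoc)
      also have "c t * (of_real (weight y u) * cis (real b ^ m * t * pos u)) = 1"
        using w by (simp add: c_def cis_mult algebra_simps)
      finally show ?thesis by simp
    qed
    moreover have "decaying \<sigma> (\<lambda>n t. 1 / of_real (weight y u) * cis (- (real b ^ m * pos u) * t) * transform x (m + n) (real (b ^ m) * t))"
      using b by (intro decaying_rescale decaying_shift[OF dec] \<open>\<sigma> \<ge> 0\<close>) auto
    ultimately show "decaying \<sigma> (\<lambda>n t. transform z n t - k n t)" by (simp add: c_def)
  qed
  then show ?thesis by blast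
qed

end

context random_projected_cascade
begin

definition decaying_alive :: "real \<Rightarrow> (nat list \<Rightarrow> real) set" where
  "decaying_alive \<sigma> = {x\<in>space P. decaying \<sigma> (transform x) \<and> (\<forall>m. alive m x)}"

lemma alive_sets: "{x\<in>space P. alive m x} \<in> sets P"
proof -
  have "{x\<in>space P. alive m x} = (\<Union>u\<in>generation B m. {x\<in>space P. 0 < weight x u})"
    by (auto simp: alive_def)
  also have "\<dots> \<in> sets P"
    using measurable_weight[OF generation_tree] by (intro sets.finite_UN finite_generation) measurable
  finally show ?thesis .
qed

lemma decaying_alive_sets [measurable]: "decaying_alive \<sigma> \<in> sets P"
proof -
  have "decaying_alive \<sigma> = {x\<in>space P. decaying \<sigma> (\<lambda>n t. transform x n t - (\<lambda>_ _. 0) n t)} \<inter> (\<Inter>m. {x\<in>space P. alive m x})"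
    by (auto simp: decaying_alive_def)
  also have "\<dots> \<in> sets P"
    by (intro sets.Int sets.countable_INT decaying_sets) (auto intro: alive_sets)
  finally show ?thesis .
qed

text \<open>
  The event \<open>A = decaying_alive \<sigma>\<close> is approximated by a set depending on the weights of the first \<open>m\<close> generations.
  Survival provides a vertex \<open>u\<close> of generation \<open>m\<close> with positive weight; choosing the first such vertex
  splits the approximating event into disjoint pieces, and on one of them \<open>A\<close> fails with
  relative probability less than \<open>\<epsilon>\<close>. The piece is not affected when the subtree below \<open>u\<close> is resampled, so by
  Fubini some configuration \<open>y\<close> in it leads to \<open>A\<close> with probability more than \<open>1 - \<epsilon>\<close> after resampling.
\<close>

lemma decaying_up_to_small_probability:
  assumes "\<sigma> \<ge> 0" and p: "P.prob (decaying_alive \<sigma>) > 0" and e: "\<epsilon> > 0"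
  obtains k where "1 - \<epsilon> < P.prob {x\<in>space P. decaying \<sigma> (\<lambda>n t. transform x n t - k n t)}"
proof -
  define A where "A = decaying_alive \<sigma>"
  have A_sets[measurable]: "A \<in> sets P" by (simp add: A_def)
  \<comment> \<open>the solution of \<open>\<delta> = \<epsilon> * (prob A - \<delta>)\<close>\<close>
  define \<delta> where "\<delta> = \<epsilon> * P.prob A / (1 + \<epsilon>)"
  have "\<delta> > 0" using p e by (simp add: \<delta>_def A_def)
  obtain A' J where A'_sets[measurable]: "A' \<in> sets P" and J: "finite J" "J \<subseteq> vertices"
    and cyl: "\<And>x y. x \<in> A' \<Longrightarrow> y \<in> space P \<Longrightarrow> (\<And>i. i \<in> J \<Longrightarrow> y i = x i) \<Longrightarrow> y \<in> A'"
    and approx: "P.prob (sym_diff A A') < \<delta>"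
    using PiM_finite_coordinates_approx[of "\<lambda>_. D" A vertices \<delta>] D.prob_space_axioms A_sets \<open>\<delta> > 0\<close>
    unfolding P_def by metis
  obtain m where m: "\<And>v. v \<in> J \<Longrightarrow> length v \<le> m"
    using finite_nat_set_iff_bounded_le[THEN iffD1, OF finite_imageI[OF J(1), of length]] by blast
  define piece where "piece u = {x\<in>A'. 0 < weight x u \<and>
    (\<forall>u'\<in>generation B m. to_nat u' < to_nat u \<longrightarrow> weight x u' \<le> 0)}" for u
  have A'_space: "A' \<subseteq> space P" by (rule sets.sets_into_space) simp
  have piece_sets: "piece u \<in> sets P" if "u \<in> generation B m" for u
  proof -
    have [measurable]: "(\<lambda>x. weight x v) \<in> borel_measurable P" if "v \<in> generation B m" for v
      using generation_tree[OF that] by (rule measurable_weight)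
    have "piece u = A' \<inter> {x\<in>space P. 0 < weight x u} \<inter>
        {x\<in>space P. \<forall>u'\<in>generation B m. to_nat u' < to_nat u \<longrightarrow> weight x u' \<le> 0}"
      using A'_space by (auto simp: piece_def)
    also have "\<dots> \<in> sets P" using that by measurable
    finally show ?thesis .
  qed
  have disj: "disjoint_family_on piece (generation B m)"
  proof (unfold disjoint_family_on_def, intro ballI impI)
    fix u u' assume u: "u \<in> generation B m" "u' \<in> generation B m" "u \<noteq> u'"
    then have "to_nat u < to_nat u' \<or> to_nat u' < to_nat u" by (metis from_nat_to_nat linorder_neqE_nat)
    then show "piece u \<inter> piece u' = {}" using u by (fastforce simp: piece_def)
  qed
  have cover: "x \<in> (\<Union>u\<in>generation B m. piece u)" if "x \<in> A'" "alive m x" for x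
  proof -
    from that obtain u0 where "u0 \<in> generation B m \<and> 0 < weight x u0" by (auto simp: alive_def)
    obtain u where u: "u \<in> generation B m \<and> 0 < weight x u"
      "\<And>u'. u' \<in> generation B m \<and> 0 < weight x u' \<Longrightarrow> to_nat u \<le> to_nat u'"
      using ex_has_least_nat[of "\<lambda>u. u \<in> generation B m \<and> 0 < weight x u" u0 to_nat]
        \<open>u0 \<in> generation B m \<and> 0 < weight x u0\<close> by blast
    then have "x \<in> piece u" using that(1) by (force simp: piece_def not_less)
    then show ?thesis using u by blast
  qed
  define A'' where "A'' = (\<Union>u\<in>generation B m. piece u)"
  have A''_sets[measurable]: "A'' \<in> sets P"
    unfolding A''_def using piece_sets by (intro sets.finite_UN finite_generation) auto
  have A''_A': "A'' \<subseteq> A'" by (auto simp: A''_def piece_def)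
  have "A - A'' \<subseteq> A - A'"
    using cover unfolding A_def decaying_alive_def A''_def by blast
  have "\<exists>u\<in>generation B m. P.prob (piece u - A) < \<epsilon> * P.prob (piece u)"
  proof (rule ccontr)
    assume "\<not> ?thesis"
    then have "(\<Sum>u\<in>generation B m. \<epsilon> * P.prob (piece u)) \<le> (\<Sum>u\<in>generation B m. P.prob (piece u - A))"
      by (intro sum_mono) auto
    also have "\<dots> = P.prob (\<Union>u\<in>generation B m. piece u - A)"
      using piece_sets disj
      by (intro P.finite_measure_finite_Union[symmetric] finite_generation) (auto simp: disjoint_family_on_def)
    also have "(\<Union>u\<in>generation B m. piece u - A) = A'' - A" by (auto simp: A''_def)
    also have "P.prob (A'' - A) \<le> P.prob (sym_diff A A')"
      using A''_A' by (intro P.finite_measure_mono) auto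
    also have "(\<Sum>u\<in>generation B m. \<epsilon> * P.prob (piece u)) = \<epsilon> * P.prob A''"
      unfolding A''_def using piece_sets disj
      by (subst P.finite_measure_finite_Union[OF finite_generation]) (auto simp: sum_distrib_left)
    finally have 1: "\<epsilon> * P.prob A'' < \<delta>" using approx by simp
    have "P.prob A \<le> P.prob (A'' \<union> (A - A''))" by (intro P.finite_measure_mono) auto
    also have "\<dots> \<le> P.prob A'' + P.prob (A - A'')" by (intro measure_Un_le) auto
    also have "P.prob (A - A'') \<le> P.prob (sym_diff A A')"
      using \<open>A - A'' \<subseteq> A - A'\<close> by (intro P.finite_measure_mono) auto
    finally have "\<epsilon> * (P.prob A - \<delta>) < \<epsilon> * P.prob A''" using approx e by simp
    moreover have "\<epsilon> * (P.prob A - \<delta>) = \<delta>" using e by (simp add: \<delta>_def field_simps)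
    ultimately show False using 1 by simp
  qed
  then obtain u where u: "u \<in> generation B m" and small: "P.prob (piece u - A) < \<epsilon> * P.prob (piece u)"
    by blast
  have [measurable]: "piece u \<in> sets P" by (rule piece_sets[OF u])
  define K where "K = (@) u ` vertices"
  define T where "T = (\<lambda>(y, z). \<lambda>v\<in>vertices. if v \<in> K then z (drop (length u) v) else (y v :: real))"
  have distrT: "distr (P \<Otimes>\<^sub>M P) P T = P"
    unfolding P_def T_def
    by (rule distr_PiM_resample) (auto simp: K_def inj_on_def D.prob_space_axioms)
  have T_meas[measurable]: "T \<in> P \<Otimes>\<^sub>M P \<rightarrow>\<^sub>M P"
  proof -
    have "(\<lambda>p. if v \<in> K then snd p (drop (length u) v) else fst p v) \<in> P \<Otimes>\<^sub>M P \<rightarrow>\<^sub>M D" if v: "v \<in> vertices" for v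
    proof (cases "v \<in> K")
      case True
      then have "drop (length u) v \<in> vertices" by (auto simp: K_def)
      then show ?thesis using True unfolding P_def
        by (auto intro!: measurable_compose[OF measurable_snd measurable_component_singleton])
    next
      case False
      then show ?thesis using v unfolding P_def
        by (auto intro!: measurable_compose[OF measurable_fst measurable_component_singleton])
    qed
    then have "(\<lambda>p. \<lambda>v\<in>vertices. if v \<in> K then snd p (drop (length u) v) else fst p v)
        \<in> P \<Otimes>\<^sub>M P \<rightarrow>\<^sub>M PiM vertices (\<lambda>_. D)"
      by (rule measurable_restrict)
    then show ?thesis unfolding T_def case_prod_unfold P_def[symmetric] .
  qed
  have T_short: "T (y, z) v = y v" if "v \<in> vertices" "length v \<le> m" for y z v
    using that u by (auto simp: T_def K_def generation_length)
  have T_piece: "T (y, z) \<in> piece u" if y: "y \<in> piece u" and z: "z \<in> space P" for y z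
  proof -
    have ysp: "y \<in> space P" using y A'_space by (auto simp: piece_def)
    have "T (y, z) \<in> space P"
      using measurable_space[OF T_meas, of "(y, z)"] ysp z by (simp add: space_pair_measure)
    then have "T (y, z) \<in> A'"
    proof (rule cyl[rotated])
      show "y \<in> A'" using y by (simp add: piece_def)
      show "T (y, z) i = y i" if "i \<in> J" for i
        using that J(2) m by (intro T_short) auto
    qed
    moreover have "weight (T (y, z)) v = weight y v" if "v \<in> generation B m" for v
      using generation_tree[OF that] by (rule weight_cong) (simp add: T_short generation_length[OF that])
    ultimately show ?thesis using y u by (simp add: piece_def)
  qed
  have sec_sets[measurable]: "{z\<in>space P. T (y, z) \<in> S} \<in> sets P" if "y \<in> space P" "S \<in> sets P" for y S
  proof -
    have "(\<lambda>z. T (y, z)) \<in> P \<rightarrow>\<^sub>M P"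
      using measurable_compose[OF measurable_Pair1'[OF that(1)] T_meas] .
    then show ?thesis using measurable_sets[OF _ that(2)] by (simp add: vimage_def Int_def conj_commute)
  qed
  have "\<exists>y\<in>piece u. P.prob {z\<in>space P. T (y, z) \<notin> A} < \<epsilon>"
  proof (rule ccontr)
    assume "\<not> ?thesis"
    then have large: "\<epsilon> \<le> P.prob {z\<in>space P. T (y, z) \<notin> A}" if "y \<in> piece u" for y
      using that by force
    have "ennreal (\<epsilon> * P.prob (piece u)) = ennreal \<epsilon> * emeasure P (piece u)"
      using e by (simp add: P.emeasure_eq_measure ennreal_mult)
    also have "\<dots> = (\<integral>\<^sup>+y. ennreal \<epsilon> * indicator (piece u) y \<partial>P)"
      by (simp add: nn_integral_cmult_indicator)
    also have "\<dots> \<le> (\<integral>\<^sup>+y. emeasure P (Pair y -` (T -` (piece u - A) \<inter> space (P \<Otimes>\<^sub>M P))) \<partial>P)"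
    proof (rule nn_integral_mono)
      fix y assume y: "y \<in> space P"
      show "ennreal \<epsilon> * indicator (piece u) y \<le> emeasure P (Pair y -` (T -` (piece u - A) \<inter> space (P \<Otimes>\<^sub>M P)))"
      proof (cases "y \<in> piece u")
        case True
        then have "Pair y -` (T -` (piece u - A) \<inter> space (P \<Otimes>\<^sub>M P)) = {z\<in>space P. T (y, z) \<notin> A}"
          using T_piece[OF True] y by (auto simp: space_pair_measure)
        then show ?thesis using True large[OF True] e
          by (simp add: P.emeasure_eq_measure ennreal_leI)
      qed simp
    qed
    also have "\<dots> = emeasure (P \<Otimes>\<^sub>M P) (T -` (piece u - A) \<inter> space (P \<Otimes>\<^sub>M P))"
      by (rule P.emeasure_pair_measure_alt[symmetric]) measurable
    also have "\<dots> = emeasure (distr (P \<Otimes>\<^sub>M P) P T) (piece u - A)"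
      by (subst emeasure_distr) auto
    also have "\<dots> = ennreal (P.prob (piece u - A))"
      unfolding distrT by (rule P.emeasure_eq_measure)
    finally have "\<epsilon> * P.prob (piece u) \<le> P.prob (piece u - A)" by (simp add: ennreal_le_iff)
    then show False using small by simp
  qed
  then obtain y where y: "y \<in> piece u" and prob: "P.prob {z\<in>space P. T (y, z) \<notin> A} < \<epsilon>" by blast
  have ysp: "y \<in> space P" using y A'_space by (auto simp: piece_def)
  have wy: "weight y u > 0" using y by (simp add: piece_def)
  from decaying_resampled_subtree[OF \<open>\<sigma> \<ge> 0\<close> u wy] obtain k where
    k: "\<forall>x z. decaying \<sigma> (transform x) \<and> (\<forall>v\<in>vertices. x (u @ v) = z v) \<and>
      (\<forall>v\<in>vertices. v \<notin> (@) u ` vertices \<longrightarrow> x v = y v) \<longrightarrow>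
      decaying \<sigma> (\<lambda>n t. transform z n t - k n t)" ..
  have "1 - \<epsilon> < P.prob {z\<in>space P. T (y, z) \<in> A}"
  proof -
    have "P.prob {z\<in>space P. T (y, z) \<notin> A} = 1 - P.prob {z\<in>space P. T (y, z) \<in> A}"
      by (rule P.prob_neg) (rule sec_sets[OF ysp A_sets])
    then show ?thesis using prob by simp
  qed
  also have "\<dots> \<le> P.prob {z\<in>space P. decaying \<sigma> (\<lambda>n t. transform z n t - k n t)}"
  proof (rule P.finite_measure_mono)
    show "{z\<in>space P. T (y, z) \<in> A} \<subseteq> {z\<in>space P. decaying \<sigma> (\<lambda>n t. transform z n t - k n t)}"
    proof safe
      fix z assume "z \<in> space P" "T (y, z) \<in> A"
      then have "decaying \<sigma> (transform (T (y, z)))" by (simp add: A_def decaying_alive_def)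
      moreover have "\<forall>v\<in>vertices. T (y, z) (u @ v) = z v"
        using u by (auto simp: T_def K_def tree_append generation_tree)
      moreover have "\<forall>v\<in>vertices. v \<notin> (@) u ` vertices \<longrightarrow> T (y, z) v = y v"
        by (simp add: T_def K_def)
      ultimately show "decaying \<sigma> (\<lambda>n t. transform z n t - k n t)" using k by blast
    qed
  qed (rule decaying_sets)
  finally show thesis by (rule that)
qed

text \<open>
  Two of the sets \<open>S k\<close> that meet are equal, since \<open>k\<close> then changes by a decaying sequence only.
  Two of probability above \<open>1/2\<close> do meet, so a single \<open>S k\<close> has full probability, and
  it meets the event of positive probability on which the transform itself decays.
\<close>

lemma decaying_zero_one:
  assumes "\<sigma> \<ge> 0" and p: "P.prob (decaying_alive \<sigma>) > 0"
  shows "AE x in P. decaying \<sigma> (transform x)"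
proof -
  define S where "S k = {x\<in>space P. decaying \<sigma> (\<lambda>n t. transform x n t - k n t)}" for k
  have S_sets[measurable]: "S k \<in> sets P" for k unfolding S_def by (rule decaying_sets)
  have ex: "\<exists>k. 1 - \<epsilon> < P.prob (S k)" if "\<epsilon> > 0" for \<epsilon>
    using decaying_up_to_small_probability[OF assms that] unfolding S_def by metis
  obtain k where k: "1 - 1/2 < P.prob (S k)" using ex[of "1/2"] by auto
  have near: "1 - \<epsilon> \<le> P.prob (S k)" if "0 < \<epsilon>" for \<epsilon>
  proof -
    have "min \<epsilon> (1/2) > 0" using that by simp
    then obtain k' where k': "1 - min \<epsilon> (1/2) < P.prob (S k')" using ex by blast
    have "S k \<inter> S k' \<noteq> {}"
    proof
      assume "S k \<inter> S k' = {}"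
      then have "P.prob (S k) + P.prob (S k') = P.prob (S k \<union> S k')"
        by (intro P.finite_measure_Union[symmetric]) auto
      also have "\<dots> \<le> 1" by simp
      finally show False using k k' by linarith
    qed
    then obtain x where "x \<in> S k" "x \<in> S k'" by blast
    then have kk': "decaying \<sigma> (\<lambda>n t. k n t - k' n t)"
      using decaying_diff[of \<sigma> "\<lambda>n t. transform x n t - k' n t" "\<lambda>n t. transform x n t - k n t"] by (simp add: S_def)
    have "S k' \<subseteq> S k"
      using decaying_diff[OF _ kk'] by (fastforce simp: S_def)
    then have "P.prob (S k') \<le> P.prob (S k)" by (intro P.finite_measure_mono) auto
    then show ?thesis using k' by linarith
  qed
  have "1 \<le> P.prob (S k)"
  proof (rule field_le_epsilon)
    fix e :: real assume "0 < e"
    from near[OF this] show "1 \<le> P.prob (S k) + e" by linarith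
  qed
  then have "P.prob (S k) = 1" using P.prob_le_1[of "S k"] by linarith
  then have AE_S: "AE x in P. x \<in> S k" by (rule P.AE_prob_1)
  have "\<exists>x. x \<in> decaying_alive \<sigma> \<and> x \<in> S k"
  proof (rule ccontr)
    assume "\<not> ?thesis"
    then have "AE x in P. x \<notin> decaying_alive \<sigma>"
      by (intro eventually_mono[OF AE_S]) blast
    then have "P.prob (decaying_alive \<sigma>) = 0"
      by (simp add: P.prob_eq_0)
    then show False using p by simp
  qed
  then obtain x where x: "decaying \<sigma> (transform x)" "decaying \<sigma> (\<lambda>n t. transform x n t - k n t)"
    by (auto simp: decaying_alive_def S_def)
  have "decaying \<sigma> (\<lambda>n t. transform x n t - k n t - transform x n t)" by (rule decaying_diff[OF x(2,1)])
  then have k0: "decaying \<sigma> (\<lambda>n t. - k n t)" by simp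
  show ?thesis
    using AE_S
  proof eventually_elim
    case (elim x)
    then have "decaying \<sigma> (\<lambda>n t. transform x n t - k n t)" by (simp add: S_def)
    from decaying_diff[OF this k0] show ?case by simp
  qed
qed

text \<open>
  If decay and survival have positive probability together, then by the zero-one law almost surely all
  subcascades decay and no mass is left; otherwise a decaying cascade dies out at a finite generation.
\<close>

lemma AE_decaying_imp_mass_zero:
  assumes "\<sigma> > 1"
  shows "AE x in P. decaying \<sigma> (transform x) \<longrightarrow> (\<lambda>n. transform x n 0) \<longlonglongrightarrow> 0"
proof (cases "P.prob (decaying_alive \<sigma>) > 0")
  case True
  have "AE x in P. decaying \<sigma> (transform x)" using \<open>\<sigma> > 1\<close> True by (intro decaying_zero_one) auto
  then have "AE x in P. \<forall>u\<in>tree B. decaying \<sigma> (transform (shifted x u))"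
    by (intro AE_ball_countable' AE_decaying_sub) auto
  then show ?thesis using AE_nonneg
  proof eventually_elim
    case (elim x)
    then show ?case using all_decaying_imp_mass_zero[OF _ _ \<open>\<sigma> > 1\<close>] by blast
  qed
next
  case False
  then have "P.prob (decaying_alive \<sigma>) = 0" using measure_nonneg[of P "decaying_alive \<sigma>"] by linarith
  then have "AE x in P. x \<notin> decaying_alive \<sigma>" by (simp add: P.prob_eq_0)
  then show ?thesis using AE_nonneg AE_space
  proof eventually_elim
    case (elim x)
    then show ?case using not_alive_imp_mass_zero by (auto simp: decaying_alive_def)
  qed
qed

end

section \<open>From the cascade to its projection\<close>

lemma compact_cube: "compact (cube b c u)"
  unfolding cube_def by (rule compact_affinity) (rule compact_cbox)

lemma integral_cascade_approx:
  fixes f :: "real ^ 'd \<Rightarrow> real"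
  assumes nonneg: "\<And>u. u \<in> tree (b ^ CARD('d)) - {[]} \<Longrightarrow> 0 \<le> X u \<omega>"
    and cont: "continuous_on UNIV f"
  shows "(\<integral>x. f x \<partial>cascade_approx b c X n \<omega>) =
    (\<Sum>u\<in>generation (b ^ CARD('d)) n. path_product X u \<omega> * (\<integral>x. indicator (cube b c u) x * f x \<partial>lborel))"
proof -
  have [measurable]: "cube b c u \<in> sets borel" for u
    by (intro borel_closed compact_imp_closed compact_cube)
  have [measurable]: "f \<in> borel_measurable borel" using cont by (rule borel_measurable_continuous_onI)
  have pp: "0 \<le> path_product X u \<omega>" if "u \<in> generation (b ^ CARD('d)) n" for u
    unfolding path_product_def
  proof (intro prod_nonneg nonneg)
    fix k assume "k \<in> {1..length u}"
    then show "take k u \<in> tree (b ^ CARD('d)) - {[]}"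
      using that by (auto simp: generation_def tree_def dest: in_set_takeD)
  qed
  have int: "integrable lborel (\<lambda>x. indicator (cube b c u) x * f x)" for u
    using borel_integrable_compact[OF compact_cube continuous_on_subset[OF cont subset_UNIV]]
    by simp
  have dens: "(\<Sum>u\<in>generation (b ^ CARD('d)) n. ennreal (path_product X u \<omega>) * indicator (cube b c u) x)
     = ennreal (\<Sum>u\<in>generation (b ^ CARD('d)) n. path_product X u \<omega> * indicator (cube b c u) x)" for x
    using pp by (subst sum_ennreal[symmetric]) (auto simp: ennreal_mult ennreal_indicator intro!: sum.cong)
  have "(\<integral>x. f x \<partial>cascade_approx b c X n \<omega>)
    = (\<integral>x. (\<Sum>u\<in>generation (b ^ CARD('d)) n. path_product X u \<omega> * indicator (cube b c u) x) *\<^sub>R f x \<partial>lborel)"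
    unfolding cascade_approx_def dens
    using pp by (subst integral_density) (auto intro!: sum_nonneg)
  also have "\<dots> = (\<integral>x. (\<Sum>u\<in>generation (b ^ CARD('d)) n. path_product X u \<omega> * (indicator (cube b c u) x * f x)) \<partial>lborel)"
    by (simp add: sum_distrib_right mult.assoc)
  also have "\<dots> = (\<Sum>u\<in>generation (b ^ CARD('d)) n. path_product X u \<omega> * (\<integral>x. indicator (cube b c u) x * f x \<partial>lborel))"
    by (subst Bochner_Integration.integral_sum) (auto intro!: integrable_mult_right int)
  finally show ?thesis .
qed

lemma integral_cube_approx:
  fixes f :: "real ^ 'd \<Rightarrow> real"
  assumes "b \<ge> 2" and cont: "continuous_on UNIV f"
    and lip: "\<And>x y. \<bar>f x - f y\<bar> \<le> L * \<bar>x $ i - y $ i\<bar>" and "L \<ge> 0"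
  shows "\<bar>(\<integral>x. indicator (cube b c u) x * f x \<partial>lborel) - f (corner b c u) / real (b ^ CARD('d)) ^ length u\<bar>
    \<le> L / real b ^ length u * (1 / real (b ^ CARD('d)) ^ length u)"
proof -
  have [measurable]: "cube b c u \<in> sets borel"
    by (intro borel_closed compact_imp_closed compact_cube)
  have vol: "measure lborel (cube b c u) = 1 / real (b ^ CARD('d)) ^ length u"
  proof -
    have "cube b c u = (\<lambda>x. (1 / real b ^ length u) *\<^sub>R x + corner b c u) ` cbox 0 1"
      by (simp add: cube_def add.commute)
    then have "measure lborel (cube b c u) = (1 / real b ^ length u) ^ CARD('d) * measure lborel (cbox 0 (1::real ^ 'd))"
      by (simp add: content_image_affinity_cbox)
    also have "measure lborel (cbox 0 (1::real ^ 'd)) = 1"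
      by (subst content_cbox_cart) (auto simp: interval_ne_empty_cart)
    finally show ?thesis
      by (simp add: power_one_over power_mult[symmetric] mult.commute)
  qed
  have int: "integrable lborel (\<lambda>x. indicator (cube b c u) x * g x)" if "continuous_on UNIV g" for g :: "real ^ 'd \<Rightarrow> real"
    using borel_integrable_compact[OF compact_cube continuous_on_subset[OF that subset_UNIV]] by simp
  have const: "(\<integral>x. indicator (cube b c u) x * k \<partial>lborel) = k * (1 / real (b ^ CARD('d)) ^ length u)" for k :: real
    by (simp add: vol)
  have "(\<integral>x. indicator (cube b c u) x * f x \<partial>lborel) - f (corner b c u) / real (b ^ CARD('d)) ^ length u
     = (\<integral>x. indicator (cube b c u) x * f x \<partial>lborel) - (\<integral>x. indicator (cube b c u) x * f (corner b c u) \<partial>lborel)"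
    by (simp add: vol)
  also have "\<dots> = (\<integral>x. indicator (cube b c u) x * (f x - f (corner b c u)) \<partial>lborel)"
    unfolding right_diff_distrib
    by (rule Bochner_Integration.integral_diff[OF int[OF cont] int[OF continuous_on_const], symmetric])
  also have "\<bar>\<dots>\<bar> \<le> (\<integral>x. \<bar>indicator (cube b c u) x * (f x - f (corner b c u))\<bar> \<partial>lborel)"
    by (rule integral_abs_bound)
  also have "\<dots> \<le> (\<integral>x. indicator (cube b c u) x * (L / real b ^ length u) \<partial>lborel)"
  proof (rule integral_mono)
    show "integrable lborel (\<lambda>x. \<bar>indicator (cube b c u) x * (f x - f (corner b c u))\<bar>)"
      by (intro integrable_abs int continuous_intros cont)
    show "integrable lborel (\<lambda>x. indicator (cube b c u) x * (L / real b ^ length u))"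
      by (intro int continuous_intros)
    fix x
    show "\<bar>indicator (cube b c u) x * (f x - f (corner b c u))\<bar> \<le> indicator (cube b c u) x * (L / real b ^ length u)"
    proof (cases "x \<in> cube b c u")
      case True
      then obtain y where y: "y \<in> cbox 0 1" "x = corner b c u + (1 / real b ^ length u) *\<^sub>R y"
        by (auto simp: cube_def)
      then have "0 \<le> y $ i" "y $ i \<le> 1" by (auto simp: mem_box_cart)
      then have "\<bar>x $ i - corner b c u $ i\<bar> \<le> 1 / real b ^ length u"
        using y by (simp add: abs_mult divide_right_mono)
      then have "L * \<bar>x $ i - corner b c u $ i\<bar> \<le> L * (1 / real b ^ length u)"
        by (rule mult_left_mono) fact
      then show ?thesis using True order_trans[OF lip[of x "corner b c u"]] by simp
    qed simp
  qed
  also have "\<dots> = L / real b ^ length u * (1 / real (b ^ CARD('d)) ^ length u)" by (rule const)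
  finally show ?thesis .
qed

lemma projected_cascade_labelling:
  fixes c :: "nat \<Rightarrow> real ^ 'd"
  assumes "b \<ge> 2" "subcube_labelling b c"
  shows "projected_cascade b (b ^ CARD('d)) (\<lambda>j. c j $ i)"
proof
  show "1 \<le> b ^ CARD('d)" using assms(1) by simp
  fix j assume "j \<in> {1..b ^ CARD('d)}"
  then have "c j \<in> {v. \<forall>i. \<exists>j<b. v $ i = real j / real b}"
    using assms(2) bij_betwE unfolding subcube_labelling_def by blast
  then show "\<exists>k<b. c j $ i = real k / real b" by blast
qed (fact assms(1))

text \<open>
  Moving the mass of each cube of generation \<open>n\<close> to its corner changes the integral of a Lipschitz function
  of the \<open>i\<close>-th coordinate by at most a constant times the total mass times \<open>b ^ - n\<close>. This is applied to the
  constant \<open>1\<close>, which shows that the total masses stay bounded, and to the real and imaginary parts of the character.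
\<close>

lemma transform_tendsto_fourier_integral:
  fixes c :: "nat \<Rightarrow> real ^ 'd" and i :: 'd
  assumes b: "b \<ge> 2" and lab: "subcube_labelling b c"
    and nonneg: "\<And>u. u \<in> tree (b ^ CARD('d)) - {[]} \<Longrightarrow> 0 \<le> X u \<omega>"
    and weak: "weakly_converges (\<lambda>n. cascade_approx b c X n \<omega>) \<nu>"
    and \<nu>: "finite_measure \<nu>" "sets \<nu> = sets borel"
  shows "(\<lambda>n. projected_cascade.transform b (b ^ CARD('d)) (\<lambda>j. c j $ i) (\<lambda>u. X u \<omega>) n t)
     \<longlonglongrightarrow> (CLINT x|\<nu>. cis (t * x $ i))"
proof -
  interpret projected_cascade b "b ^ CARD('d)" "\<lambda>j. c j $ i"
    by (rule projected_cascade_labelling[OF b lab])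
  interpret \<nu>: finite_measure \<nu> by fact
  let ?B = "b ^ CARD('d)"
  let ?x = "\<lambda>u. X u \<omega>"
  have weight: "weight ?x u = path_product X u \<omega> / real ?B ^ length u" for u
    by (simp add: weight_def path_product_def)
  have corner: "corner b c u $ i = pos u" for u
    by (induction u) auto
  have w0: "0 \<le> weight ?x u" if "u \<in> generation ?B n" for u n
    using weight_nonneg[of ?x u] generation_tree[OF that] nonneg by (simp add: nonneg_def)
  have close: "\<bar>(\<integral>x. f x \<partial>cascade_approx b c X n \<omega>) - (\<Sum>u\<in>generation ?B n. weight ?x u * f (corner b c u))\<bar>
      \<le> L / real b ^ n * (\<Sum>u\<in>generation ?B n. weight ?x u)"
    if f: "continuous_on UNIV f" "\<And>x y. \<bar>f x - f y\<bar> \<le> L * \<bar>x $ i - y $ i\<bar>" "L \<ge> 0"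
    for f :: "real ^ 'd \<Rightarrow> real" and L n
  proof -
    have I: "(\<integral>x. f x \<partial>cascade_approx b c X n \<omega>)
      = (\<Sum>u\<in>generation ?B n. path_product X u \<omega> * (\<integral>x. indicator (cube b c u) x * f x \<partial>lborel))"
      by (rule integral_cascade_approx[OF _ f(1)]) (rule nonneg)
    have "(\<integral>x. f x \<partial>cascade_approx b c X n \<omega>) - (\<Sum>u\<in>generation ?B n. weight ?x u * f (corner b c u))
      = (\<Sum>u\<in>generation ?B n. path_product X u \<omega> *
          ((\<integral>x. indicator (cube b c u) x * f x \<partial>lborel) - f (corner b c u) / real ?B ^ length u))"
      unfolding I by (simp add: weight sum_subtractf right_diff_distrib)
    also have "\<bar>\<dots>\<bar> \<le> (\<Sum>u\<in>generation ?B n. path_product X u \<omega> * (L / real b ^ n * (1 / real ?B ^ length u)))"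
    proof (rule order_trans[OF sum_abs], rule sum_mono)
      fix u assume u: "u \<in> generation ?B n"
      have "0 \<le> path_product X u \<omega>"
        using w0[OF u] b by (simp add: weight zero_le_divide_iff not_le flip: of_nat_power)
      then show "\<bar>path_product X u \<omega> *
          ((\<integral>x. indicator (cube b c u) x * f x \<partial>lborel) - f (corner b c u) / real ?B ^ length u)\<bar>
          \<le> path_product X u \<omega> * (L / real b ^ n * (1 / real ?B ^ length u))"
        using mult_left_mono[OF integral_cube_approx[OF b f, of c u], of "path_product X u \<omega>"]
          generation_length[OF u]
        by (simp only: abs_mult abs_of_nonneg)
    qed
    also have "\<dots> = L / real b ^ n * (\<Sum>u\<in>generation ?B n. weight ?x u)"
      by (simp add: weight sum_distrib_left mult_ac)
    finally show ?thesis .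
  qed
  have conv: "(\<lambda>n. \<integral>x. f x \<partial>cascade_approx b c X n \<omega>) \<longlonglongrightarrow> (\<integral>x. f x \<partial>\<nu>)"
    if "continuous_on UNIV f" "bounded (range f)" for f :: "real ^ 'd \<Rightarrow> real"
    using weak that unfolding weakly_converges_def by blast
  have mass: "(\<lambda>n. \<Sum>u\<in>generation ?B n. weight ?x u) \<longlonglongrightarrow> (\<integral>x. 1 \<partial>\<nu>)"
  proof -
    have "(\<Sum>u\<in>generation ?B n. weight ?x u) = (\<integral>x. 1 \<partial>cascade_approx b c X n \<omega>)" for n
      using close[of "\<lambda>_. 1" 0 n] by simp
    then show ?thesis using conv[of "\<lambda>_. 1"] by simp
  qed
  have sum_lim: "(\<lambda>n. \<Sum>u\<in>generation ?B n. weight ?x u * f (corner b c u)) \<longlonglongrightarrow> (\<integral>x. f x \<partial>\<nu>)"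
    if f: "continuous_on UNIV f" "\<And>x y. \<bar>f x - f y\<bar> \<le> L * \<bar>x $ i - y $ i\<bar>" "L \<ge> 0" "bounded (range f)"
    for f :: "real ^ 'd \<Rightarrow> real" and L
  proof -
    have "(\<lambda>n. (1 / real b) ^ n) \<longlonglongrightarrow> 0" using b by (intro LIMSEQ_realpow_zero) auto
    then have "(\<lambda>n. L * (1 / real b) ^ n * (\<Sum>u\<in>generation ?B n. weight ?x u)) \<longlonglongrightarrow> L * 0 * (\<integral>x. 1 \<partial>\<nu>)"
      by (intro tendsto_mult tendsto_const mass)
    then have lim0: "(\<lambda>n. L * (1 / real b) ^ n * (\<Sum>u\<in>generation ?B n. weight ?x u)) \<longlonglongrightarrow> 0"
      by simp
    have "\<forall>\<^sub>F n in sequentially.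
        norm ((\<integral>x. f x \<partial>cascade_approx b c X n \<omega>) - (\<Sum>u\<in>generation ?B n. weight ?x u * f (corner b c u)))
        \<le> L * (1 / real b) ^ n * (\<Sum>u\<in>generation ?B n. weight ?x u)"
      using close[OF f(1-3)] by (intro always_eventually allI) (simp add: power_one_over)
    from Lim_null_comparison[OF this lim0]
    have "(\<lambda>n. (\<integral>x. f x \<partial>cascade_approx b c X n \<omega>) - (\<Sum>u\<in>generation ?B n. weight ?x u * f (corner b c u))) \<longlonglongrightarrow> 0"
      .
    from tendsto_diff[OF conv[OF f(1,4)] this] show ?thesis by simp
  qed
  have cis_int: "integrable \<nu> (\<lambda>x. cis (t * x $ i))"
  proof (rule \<nu>.integrable_const_bound[where B=1])
    have "(\<lambda>x::real ^ 'd. cis (t * x $ i)) \<in> borel_measurable borel"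
      unfolding cis_conv_exp by (intro borel_measurable_continuous_onI continuous_intros)
    then show "(\<lambda>x. cis (t * x $ i)) \<in> borel_measurable \<nu>"
      by (simp add: measurable_cong_sets[OF \<nu>(2) refl])
  qed simp
  have lip: "\<bar>Re (cis (t * r)) - Re (cis (t * s))\<bar> \<le> \<bar>t\<bar> * \<bar>r - s\<bar>"
      "\<bar>Im (cis (t * r)) - Im (cis (t * s))\<bar> \<le> \<bar>t\<bar> * \<bar>r - s\<bar>" for r s
    using abs_Re_le_cmod[of "cis (t * r) - cis (t * s)"] abs_Im_le_cmod[of "cis (t * r) - cis (t * s)"]
      norm_cis_diff_le[of "t * r" "t * s"] by (auto simp: abs_mult simp flip: right_diff_distrib)
  have "(\<lambda>n. \<Sum>u\<in>generation ?B n. weight ?x u * Re (cis (t * corner b c u $ i))) \<longlonglongrightarrow> (\<integral>x. Re (cis (t * x $ i)) \<partial>\<nu>)"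
    by (rule sum_lim[where L="\<bar>t\<bar>"])
      (auto intro!: continuous_intros boundedI[where B=1] lip[simplified])
  moreover have "(\<lambda>n. \<Sum>u\<in>generation ?B n. weight ?x u * Im (cis (t * corner b c u $ i))) \<longlonglongrightarrow> (\<integral>x. Im (cis (t * x $ i)) \<partial>\<nu>)"
    by (rule sum_lim[where L="\<bar>t\<bar>"])
      (auto intro!: continuous_intros boundedI[where B=1] lip[simplified])
  ultimately show ?thesis
    unfolding integral_Re[OF cis_int] integral_Im[OF cis_int] corner transform_def
    by (subst tendsto_complex_iff) simp
qed

text \<open>
  For large \<open>t\<close> this is the hypothesis at the point \<open>axis i (- t / (2 * pi))\<close>; for bounded \<open>t\<close> the total mass is a bound.
\<close>

lemma fourier_decay_along_axis:
  fixes \<nu> :: "(real ^ 'd) measure" and i :: 'd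
  assumes \<nu>: "finite_measure \<nu>" "sets \<nu> = sets borel"
    and O: "(\<lambda>\<xi>. norm (fourier_transform \<nu> \<xi>)) \<in> O[at_infinity](\<lambda>\<xi>. norm \<xi> powr (- s / 2))"
    and \<sigma>: "0 \<le> \<sigma>" "\<sigma> \<le> s / 2"
  obtains C where "\<And>t. norm (CLINT x|\<nu>. cis (t * x $ i)) \<le> C * (1 + \<bar>t\<bar>) powr - \<sigma>"
proof -
  interpret \<nu>: finite_measure \<nu> by fact
  define h where "h t = (CLINT x|\<nu>. cis (t * x $ i))" for t
  have ft_h: "fourier_transform \<nu> (axis i (- t / (2 * pi))) = h t" for t
    unfolding fourier_transform_def h_def cis_conv_exp
    by (intro Bochner_Integration.integral_cong refl) (simp add: inner_axis mult_ac)
  have "norm (h t) \<le> (\<integral>x. norm (cis (t * x $ i)) \<partial>\<nu>)" for t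
    unfolding h_def by (rule integral_norm_bound)
  then have h_mass: "norm (h t) \<le> measure \<nu> (space \<nu>)" for t by simp
  from O obtain A where A: "A > 0"
    "\<forall>\<^sub>F \<xi> in at_infinity. norm (norm (fourier_transform \<nu> \<xi>)) \<le> A * norm (norm \<xi> powr (- s / 2))"
    by (rule landau_o.bigE)
  then obtain R0 where R0: "\<And>\<xi>. R0 \<le> norm \<xi> \<Longrightarrow> norm (fourier_transform \<nu> \<xi>) \<le> A * norm \<xi> powr (- s / 2)"
    unfolding eventually_at_infinity by auto
  define R where "R = 2 * pi * max 1 R0"
  have "R > 1" using pi_gt3 by (simp add: R_def less_max_iff_disj) (smt (verit) max.cobounded1 mult_less_cancel_left2)
  define C where "C = max (measure \<nu> (space \<nu>) * (1 + R) powr \<sigma>) (A * (4 * pi) powr \<sigma>)"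
  have "norm (h t) \<le> C * (1 + \<bar>t\<bar>) powr - \<sigma>" for t
  proof (cases "\<bar>t\<bar> \<le> R")
    case True
    have "measure \<nu> (space \<nu>) * (1 + \<bar>t\<bar>) powr \<sigma> \<le> measure \<nu> (space \<nu>) * (1 + R) powr \<sigma>"
      using True \<sigma> by (intro mult_left_mono powr_mono2) auto
    also have "\<dots> \<le> C" by (simp add: C_def)
    finally have "measure \<nu> (space \<nu>) \<le> C * (1 + \<bar>t\<bar>) powr - \<sigma>"
      by (simp add: powr_minus field_simps)
    then show ?thesis using h_mass order_trans by blast
  next
    case False
    have "max 1 R0 = R / (2 * pi)" by (simp add: R_def)
    also have "\<dots> \<le> \<bar>t\<bar> / (2 * pi)" using False by (intro divide_right_mono) auto
    finally have "max 1 R0 \<le> \<bar>t\<bar> / (2 * pi)" .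
    then have t1: "1 \<le> \<bar>t\<bar> / (2 * pi)" "R0 \<le> \<bar>t\<bar> / (2 * pi)" "1 < \<bar>t\<bar>"
      using \<open>R > 1\<close> False by auto
    have "norm (axis i r :: real ^ 'd) = \<bar>r\<bar>" for r :: real
      by (simp add: norm_eq_sqrt_inner inner_axis_axis)
    then have "norm (axis i (- t / (2 * pi)) :: real ^ 'd) = \<bar>t\<bar> / (2 * pi)" by simp
    then have "norm (h t) \<le> A * (\<bar>t\<bar> / (2 * pi)) powr (- s / 2)"
      using R0[of "axis i (- t / (2 * pi))"] t1 ft_h[of t] by simp
    also have "\<dots> \<le> A * (\<bar>t\<bar> / (2 * pi)) powr - \<sigma>"
      using t1 \<sigma> A by (intro mult_left_mono powr_mono) auto
    also have "\<dots> \<le> A * ((1 + \<bar>t\<bar>) / (4 * pi)) powr - \<sigma>"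
      using t1 \<sigma> A by (intro mult_left_mono powr_mono2') (auto simp: field_simps)
    also have "\<dots> = (A * (4 * pi) powr \<sigma>) * (1 + \<bar>t\<bar>) powr - \<sigma>"
      by (simp add: powr_divide powr_minus field_simps)
    also have "\<dots> \<le> C * (1 + \<bar>t\<bar>) powr - \<sigma>" by (intro mult_right_mono) (auto simp: C_def)
    finally show ?thesis .
  qed
  then show thesis using that unfolding h_def by blast
qed

text \<open>
  Boundedness of the transform puts \<open>0\<close> into the set whose supremum defines the dimension; for an empty set
  the supremum would be an arbitrary number.
\<close>

lemma fourier_dim_gtE:
  fixes \<nu> :: "'a::euclidean_space measure"
  assumes "finite_measure \<nu>" "r < fourier_dim \<nu>"
  obtains s where "r < s" "(\<lambda>\<xi>. norm (fourier_transform \<nu> \<xi>)) \<in> O[at_infinity](\<lambda>\<xi>. norm \<xi> powr (- s / 2))"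
proof -
  interpret \<nu>: finite_measure \<nu> by fact
  let ?S = "{s. 0 \<le> s \<and> s \<le> real DIM('a) \<and>
     (\<lambda>\<xi>. norm (fourier_transform \<nu> \<xi>)) \<in> O[at_infinity](\<lambda>\<xi>. norm \<xi> powr (- s / 2))}"
  have bound: "norm (fourier_transform \<nu> \<xi>) \<le> measure \<nu> (space \<nu>)" for \<xi>
  proof -
    have "norm (fourier_transform \<nu> \<xi>) \<le> (\<integral>x. norm (exp (- 2 * complex_of_real pi * \<i> * complex_of_real (x \<bullet> \<xi>))) \<partial>\<nu>)"
      unfolding fourier_transform_def by (rule integral_norm_bound)
    then show ?thesis by (simp add: norm_exp_eq_Re)
  qed
  have "(\<lambda>\<xi>. norm (fourier_transform \<nu> \<xi>)) \<in> O[at_infinity](\<lambda>\<xi>. norm \<xi> powr (- 0 / 2))"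
  proof (rule bigoI[where c="measure \<nu> (space \<nu>)"])
    show "\<forall>\<^sub>F \<xi> in at_infinity. norm (norm (fourier_transform \<nu> \<xi>)) \<le> measure \<nu> (space \<nu>) * norm (norm (\<xi>::'a) powr (- 0 / 2))"
      unfolding eventually_at_infinity by (intro exI[of _ 1]) (use bound in auto)
  qed
  then have "0 \<in> ?S" by simp
  have "\<exists>s\<in>?S. r < s"
  proof (rule ccontr)
    assume "\<not> ?thesis"
    then have "\<And>s. s \<in> ?S \<Longrightarrow> s \<le> r" by (meson not_less)
    moreover have "?S \<noteq> {}" using \<open>0 \<in> ?S\<close> by (metis empty_iff)
    ultimately have "Sup ?S \<le> r" by (intro cSup_least)
    then show False using assms(2) by (simp add: fourier_dim_def)
  qed
  then show thesis using that by blast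
qed

lemma eq_null_measure_borel:
  assumes "finite_measure \<nu>" "sets \<nu> = sets borel" "measure \<nu> (space \<nu>) = 0"
  shows "\<nu> = null_measure borel"
proof (rule measure_eqI)
  interpret finite_measure \<nu> by fact
  fix A assume "A \<in> sets \<nu>"
  have "emeasure \<nu> A \<le> emeasure \<nu> (space \<nu>)" by (rule emeasure_space)
  then show "emeasure \<nu> A = emeasure (null_measure borel) A"
    using assms(3) by (simp add: emeasure_eq_measure)
qed (simp add: assms)

theorem proposition4p2:
  fixes N :: "'v measure" and W :: "'v \<Rightarrow> real"
    and M :: "'w measure" and X :: "nat list \<Rightarrow> 'w \<Rightarrow> real"
    and b :: nat and c :: "nat \<Rightarrow> real ^ 'd"
    and \<mu> :: "'w \<Rightarrow> (real ^ 'd) measure"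
  assumes "b \<ge> 2"
    and "prob_space N" and "W \<in> borel_measurable N"
    and "AE x in N. W x \<ge> 0"
    and "integrable N W" and "(\<integral>x. W x \<partial>N) = 1"
    and "integrable N (\<lambda>x. W x * max (log 2 (W x)) 0)"
    and "(\<integral>x. W x * log 2 (W x) \<partial>N) < real CARD('d) * log 2 (real b)"
    and "prob_space M"
    and "subcube_labelling b c"
    and "independent_copies M (tree (b ^ CARD('d)) - {[]}) X N W"
    and "mandelbrot_cascade M b c X \<mu>"
  shows "AE \<omega> in M. \<mu> \<omega> \<noteq> null_measure borel \<longrightarrow> fourier_dim (\<mu> \<omega>) \<le> 2"
proof -
  let ?B = "b ^ CARD('d)"
  let ?V = "tree ?B - {[]}"
  define D where "D = distr N borel W"
  \<comment> \<open>any coordinate axis will do\<close>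
  obtain i :: 'd where True by simp
  interpret N: prob_space N by fact
  interpret M: prob_space M by fact
  interpret D: prob_space D unfolding D_def by (rule N.prob_space_distr) fact
  interpret projected_cascade b ?B "\<lambda>j. c j $ i"
    by (rule projected_cascade_labelling) fact+
  interpret random_projected_cascade b ?B "\<lambda>j. c j $ i" D
  proof
    show "sets D = sets borel" by (simp add: D_def)
    show "AE w in D. 0 \<le> w"
      unfolding D_def using assms(3,4) by (subst AE_distr_iff) auto
  qed
  have indep: "M.indep_vars (\<lambda>_. borel) X ?V" and law: "\<And>u. u \<in> ?V \<Longrightarrow> distr M borel (X u) = D"
    using assms(11) by (auto simp: independent_copies_def D_def)
  have X_meas: "X u \<in> borel_measurable M" if "u \<in> ?V" for u
    using indep that by (simp add: M.indep_vars_def)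
  define x where "x \<omega> = (\<lambda>u\<in>?V. X u \<omega>)" for \<omega>
  have x_meas: "x \<in> M \<rightarrow>\<^sub>M PiM ?V (\<lambda>_. borel)"
    unfolding x_def by (intro measurable_restrict X_meas)
  have "[1] \<in> ?V" using B by (simp add: tree_def)
  then have "?V \<noteq> {}" by blast
  then have "distr M (PiM ?V (\<lambda>_. borel)) x = PiM ?V (\<lambda>u. distr M borel (X u))"
    unfolding x_def using indep X_meas by (subst M.indep_vars_iff_distr_eq_PiM'[symmetric]) auto
  also have "\<dots> = P" unfolding P_def by (intro PiM_cong refl law)
  finally have distr_x: "distr M (PiM ?V (\<lambda>_. borel)) x = P" .
  have transfer: "AE \<omega> in M. Q (x \<omega>)" if "AE y in P. Q y" for Q
    by (rule AE_distrD[OF x_meas]) (simp only: distr_x that)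
  have ft_x: "transform (x \<omega>) n t = transform (\<lambda>u. X u \<omega>) n t" for \<omega> n t
    by (rule transform_cong) (simp add: x_def)
  have frm: "finite_measure (\<mu> \<omega>)" "sets (\<mu> \<omega>) = sets borel" if "\<omega> \<in> space M" for \<omega>
    using assms(12) that by (auto simp: mandelbrot_cascade_def finite_random_measure_def)
  have weak: "AE \<omega> in M. weakly_converges (\<lambda>n. cascade_approx b c X n \<omega>) (\<mu> \<omega>)"
    using assms(12) by (simp add: mandelbrot_cascade_def)
  have "AE \<omega> in M. \<forall>k::nat. decaying (1 + 1 / Suc k) (transform (x \<omega>)) \<longrightarrow> (\<lambda>n. transform (x \<omega>) n 0) \<longlonglongrightarrow> 0"
    unfolding AE_all_countable by (intro allI transfer AE_decaying_imp_mass_zero) simp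
  moreover have "AE \<omega> in M. nonneg (x \<omega>)" by (intro transfer AE_nonneg)
  ultimately show ?thesis
    using weak AE_space
  proof eventually_elim
    case (elim \<omega>)
    note fin = frm[OF elim(4)]
    interpret \<mu>: finite_measure "\<mu> \<omega>" by (rule fin)
    have "0 \<le> X u \<omega>" if "u \<in> ?V" for u
      using elim(2) that by (auto simp: nonneg_def x_def)
    then have lim: "(\<lambda>n. transform (x \<omega>) n t) \<longlonglongrightarrow> (CLINT y|\<mu> \<omega>. cis (t * y $ i))" for t
      unfolding ft_x by (intro transform_tendsto_fourier_integral assms(1,10) elim(3) fin) auto
    show ?case
    proof (rule impI, rule ccontr)
      assume nz: "\<mu> \<omega> \<noteq> null_measure borel" and "\<not> fourier_dim (\<mu> \<omega>) \<le> 2"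
      then have "2 < fourier_dim (\<mu> \<omega>)" by simp
      then obtain s where s: "2 < s"
        and O: "(\<lambda>\<xi>. norm (fourier_transform (\<mu> \<omega>) \<xi>)) \<in> O[at_infinity](\<lambda>\<xi>. norm \<xi> powr (- s / 2))"
        by (rule fourier_dim_gtE[OF fin(1)])
      obtain k where k: "1 / real (Suc k) < s / 2 - 1"
        using nat_approx_posE[of "s / 2 - 1"] s by auto
      obtain C where C: "\<And>t. norm (CLINT y|\<mu> \<omega>. cis (t * y $ i)) \<le> C * (1 + \<bar>t\<bar>) powr - (1 + 1 / real (Suc k))"
        by (rule fourier_decay_along_axis[OF fin O, of "1 + 1 / real (Suc k)"]) (use k in auto)
      have "decaying (1 + 1 / real (Suc k)) (transform (x \<omega>))"
        unfolding decaying_def by (intro exI ballI conjI, rule lim, rule C)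
      then have "(\<lambda>n. transform (x \<omega>) n 0) \<longlonglongrightarrow> 0" using elim(1) by blast
      then have "(CLINT y|\<mu> \<omega>. cis (0 * y $ i)) = 0" using lim[of 0] LIMSEQ_unique by blast
      then have "measure (\<mu> \<omega>) (space (\<mu> \<omega>)) = 0" by simp
      then show False using nz eq_null_measure_borel[OF fin] by blast
    qed
  qed
qed

end
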